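(* Let $\mu$ be a $\boxplus\boxplus$-infinitely divisible distribution on $\mathbb{R}^2$ with bi-free characteristic triplet $(\mathbf{v},\mathbf{A},\tau)$. Then $\mu$ is non-full if and only if $\mathbf{A}$ is singular and $\tau$ is supported on the line $\{(s,t):\langle\mathbf{u},(s,t)\rangle=0\}$ for some $\mathbf{u}\neq\mathbf{0}$ in the kernel of $\mathbf{A}$, in which case $\mu$ is supported on the line $\{(s,t):\langle\mathbf{u},(s,t)\rangle=\langle\mathbf{u},\mathbf{v}\rangle\}$.
   Context: $\mathscr{P}_{\mathbb{R}^d}$ is the set of Borel probability measures on $\mathbb{R}^d$; points of $\mathbb{R}^2$ are written $\mathbf{x}=(s,t)$. A Borel measure on $\mathbb{R}^2$ is supported on a closed set if the complement of that set has measure zero; it is full if it is not supported on a straight line, and non-full otherwise. Bi-free $\phi$-transform and convolution. A truncated cone is $\Gamma=\Gamma_{\theta,M}=\{x+iy\in\mathbb{C}:|x|\le\theta|y|,\ |y|\ge M\}$, $\theta,M>0$. For $\nu\in\mathscr{P}_{\mathbb{R}}$ let $G_\nu(z)=\int\frac{d\nu(s)}{z-s}$, $F_\nu=1/G_\nu$; on some truncated cone there is an analytic right inverse $F_\nu^{-1}$ of $F_\nu$ with $F_\nu^{-1}(z)=(1+o(1))z$ as $z\to\infty$ in the cone, and $\phi_\nu(z)=F_\nu^{-1}(z)-z$. For $\mu\in\mathscr{P}_{\mathbb{R}^2}$, with marginals $\mu^{(1)}(B)=\mu(B\times\mathbb{R})$, $\mu^{(2)}(B)=\mu(\mathbb{R}\times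 B)$ and $G_\mu(z,w)=\int_{\mathbb{R}^2}\frac{d\mu(s,t)}{(z-s)(w-t)}$, the bi-free $\phi$-transform is $$\phi_\mu(z,w)=\frac{\phi_{\mu^{(1)}}(z)}{z}+\frac{\phi_{\mu^{(2)}}(w)}{w}+1-\frac{1}{zw\,G_\mu\big(F_{\mu^{(1)}}^{-1}(z),F_{\mu^{(2)}}^{-1}(w)\big)},$$ analytic on $\Gamma^2$ for some truncated cone $\Gamma$; it determines $\mu$. For $\mu,\nu\in\mathscr{P}_{\mathbb{R}^2}$, the bi-free convolution $\mu\boxplus\boxplus\nu$ is the unique $\rho\in\mathscr{P}_{\mathbb{R}^2}$ with $\phi_\rho=\phi_\mu+\phi_\nu$ on some $\Gamma^2$. A measure $\mu\in\mathscr{P}_{\mathbb{R}^2}$ is $\boxplus\boxplus$-infinitely divisible if for every $n\in\mathbb{N}$ it is the $n$-fold $\boxplus\boxplus$-convolution of some $\mu_n\in\mathscr{P}_{\mathbb{R}^2}$ with itself. Equivalently, $\phi_\mu$ extends analytically to $(\mathbb{C}\setminus\mathbb{R})^2$ and $$\phi_\mu(z,w)=\frac{\mathbf{v}^{(1)}}{z}+\frac{\mathbf{v}^{(2)}}{w}+\frac{a}{z^2}+\frac{c}{zw}+\frac{b}{w^2}+\int_{\mathbb{R}^2}\Big[\frac{zw}{(z-s)(w-t)}-1-\frac{sz^{-1}+tw^{-1}}{1+s^2+t^2}\Big]d\tau(s,t)$$ with $\mathbf{v}\in\mathbb{R}^2$, $\mathbf{A}=\begin{pmatrix}a&c\\c&b\end{pmatrix}$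 real positive semi-definite, and $\tau$ a positive Borel measure with $\tau(\{\mathbf{0}\})=0$, $\min\{1,\|\mathbf{x}\|^2\}\in L^1(\tau)$; the unique triplet $(\mathbf{v},\mathbf{A},\tau)$ is the bi-free characteristic triplet of $\mu$. *)

theory Defs
  imports "HOL-Probability.Probability"
begin

definition borel_prob :: "'a::topological_space measure set" where
  "borel_prob = {M. prob_space M \<and> sets M = sets borel}"

definition supported_on :: "'a::topological_space measure \<Rightarrow> 'a set \<Rightarrow> bool" where
  "supported_on M S \<longleftrightarrow> closed S \<and> emeasure M (- S) = 0"

definition straight_line :: "(real^2) set \<Rightarrow> bool" where
  "straight_line L \<longleftrightarrow> (\<exists>u c. u \<noteq> 0 \<and> L = {x. u \<bullet> x = c})"

definition full :: "(real^2) measure \<Rightarrow> bool" where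
  "full \<mu> \<longleftrightarrow> \<not> (\<exists>L. straight_line L \<and> supported_on \<mu> L)"

abbreviation non_full :: "(real^2) measure \<Rightarrow> bool" where
  "non_full \<mu> \<equiv> \<not> full \<mu>"

definition truncated_cone :: "real \<Rightarrow> real \<Rightarrow> complex set" where
  "truncated_cone \<theta> M = {z. \<bar>Re z\<bar> \<le> \<theta> * \<bar>Im z\<bar> \<and> M \<le> \<bar>Im z\<bar>}"

definition truncated_cones :: "complex set set" where
  "truncated_cones = {truncated_cone \<theta> M |\<theta> M. 0 < \<theta> \<and> 0 < M}"

definition cauchy_G :: "real measure \<Rightarrow> complex \<Rightarrow> complex" where
  "cauchy_G \<nu> z = (\<integral>s. 1 / (z - complex_of_real s) \<partial>\<nu>)"

definition cauchy_F :: "real measure \<Rightarrow> complex \<Rightarrow> complex" where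
  "cauchy_F \<nu> z = 1 / cauchy_G \<nu> z"

text \<open>
  The inverse of \<open>F\<close> and the transforms built from it are only determined as germs at infinity
  along truncated cones, so they are introduced as relations in the style of \<open>has_integral\<close>:
  the arguments are a cone and a function whose values matter on that cone only. The condition
  \<open>g z \<notin> \<real>\<close> says that \<open>g\<close> takes values in the domain of \<open>F\<close>.
\<close>

definition is_F_inverse :: "real measure \<Rightarrow> complex set \<Rightarrow> (complex \<Rightarrow> complex) \<Rightarrow> bool" where
  "is_F_inverse \<nu> \<Gamma> g \<longleftrightarrow>
     g analytic_on \<Gamma> \<and>
     (\<forall>z\<in>\<Gamma>. g z \<notin> \<real> \<and> cauchy_F \<nu> (g z) = z) \<and>
     ((\<lambda>z. g z / z) \<longlongrightarrow> 1) (inf at_infinity (principal \<Gamma>))"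

definition marginal :: "2 \<Rightarrow> (real^2) measure \<Rightarrow> real measure" where
  "marginal i \<mu> = distr \<mu> borel (\<lambda>x. x $ i)"

definition cauchy_G2 :: "(real^2) measure \<Rightarrow> complex \<Rightarrow> complex \<Rightarrow> complex" where
  "cauchy_G2 \<mu> z w =
     (\<integral>x. 1 / ((z - complex_of_real (x $ 1)) * (w - complex_of_real (x $ 2))) \<partial>\<mu>)"

text \<open>
  \<open>has_bifree_phi \<mu> \<Gamma> \<phi>\<close>: the bi-free \<open>\<phi>\<close>-transform of \<open>\<mu>\<close> is defined on \<open>\<Gamma> \<times> \<Gamma>\<close> and equals \<open>\<phi>\<close>
  there. Non-vanishing of the Cauchy transform excludes the convention \<open>1 / 0 = 0\<close>.
\<close>

definition has_bifree_phi ::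
    "(real^2) measure \<Rightarrow> complex set \<Rightarrow> (complex \<Rightarrow> complex \<Rightarrow> complex) \<Rightarrow> bool" where
  "has_bifree_phi \<mu> \<Gamma> \<phi> \<longleftrightarrow>
     (\<exists>g1 g2. is_F_inverse (marginal 1 \<mu>) \<Gamma> g1 \<and> is_F_inverse (marginal 2 \<mu>) \<Gamma> g2 \<and>
        (\<forall>z\<in>\<Gamma>. \<forall>w\<in>\<Gamma>.
           cauchy_G2 \<mu> (g1 z) (g2 w) \<noteq> 0 \<and>
           \<phi> z w = (g1 z - z) / z + (g2 w - w) / w
                    + 1 - 1 / (z * w * cauchy_G2 \<mu> (g1 z) (g2 w))))"

definition bifree_conv :: "(real^2) measure \<Rightarrow> (real^2) measure \<Rightarrow> (real^2) measure" where
  "bifree_conv \<mu> \<nu> = (THE \<rho>. \<rho> \<in> borel_prob \<and>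
     (\<exists>\<Gamma>\<in>truncated_cones. \<exists>\<phi> \<psi>.
        has_bifree_phi \<mu> \<Gamma> \<phi> \<and> has_bifree_phi \<nu> \<Gamma> \<psi> \<and>
        has_bifree_phi \<rho> \<Gamma> (\<lambda>z w. \<phi> z w + \<psi> z w)))"

text \<open>The \<open>n\<close>-fold convolution of \<open>\<nu>\<close> with itself, meaningful for \<open>n \<ge> 1\<close>.\<close>

definition bifree_power :: "nat \<Rightarrow> (real^2) measure \<Rightarrow> (real^2) measure" where
  "bifree_power n \<nu> = ((\<lambda>\<rho>. bifree_conv \<rho> \<nu>) ^^ (n - 1)) \<nu>"

definition bifree_inf_divisible :: "(real^2) measure \<Rightarrow> bool" where
  "bifree_inf_divisible \<mu> \<longleftrightarrow>
     \<mu> \<in> borel_prob \<and> (\<forall>n\<ge>1. \<exists>\<nu>\<in>borel_prob. bifree_power n \<nu> = \<mu>)"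

definition pos_semidef :: "real^'n^'n \<Rightarrow> bool" where
  "pos_semidef A \<longleftrightarrow> transpose A = A \<and> (\<forall>x. 0 \<le> x \<bullet> (A *v x))"

definition bifree_levy_khintchine ::
    "real^2 \<Rightarrow> real^2^2 \<Rightarrow> (real^2) measure \<Rightarrow> complex \<Rightarrow> complex \<Rightarrow> complex" where
  "bifree_levy_khintchine v A \<tau> z w =
     complex_of_real (v $ 1) / z + complex_of_real (v $ 2) / w
     + complex_of_real (A $ 1 $ 1) / z\<^sup>2 + complex_of_real (A $ 1 $ 2) / (z * w)
     + complex_of_real (A $ 2 $ 2) / w\<^sup>2
     + (\<integral>x. z * w / ((z - complex_of_real (x $ 1)) * (w - complex_of_real (x $ 2))) - 1
          - (complex_of_real (x $ 1) / z + complex_of_real (x $ 2) / w)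
              / complex_of_real (1 + (x $ 1)\<^sup>2 + (x $ 2)\<^sup>2) \<partial>\<tau>)"

text \<open>
  The formula is analytic on the square of the complement of the real line, so it provides the
  analytic extension of the \<open>\<phi>\<close>-transform as soon as it agrees with it on some \<open>\<Gamma> \<times> \<Gamma>\<close>.
\<close>

definition bifree_triplet ::
    "(real^2) measure \<Rightarrow> real^2 \<Rightarrow> real^2^2 \<Rightarrow> (real^2) measure \<Rightarrow> bool" where
  "bifree_triplet \<mu> v A \<tau> \<longleftrightarrow>
     pos_semidef A \<and>
     sets \<tau> = sets borel \<and> emeasure \<tau> {0} = 0 \<and> integrable \<tau> (\<lambda>x. min 1 ((norm x)\<^sup>2)) \<and>
     (\<exists>\<Gamma>\<in>truncated_cones. has_bifree_phi \<mu> \<Gamma> (bifree_levy_khintchine v A \<tau>))"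

end

theory Submission imports Defs begin

text \<open>
  Both implications come from one computation, carried out at a single point of the imaginary
  axis, in which "is supported on a line" is read as the vanishing of an \<open>L\<^sup>2\<close> distance.

  Let \<open>g\<^sub>1, g\<^sub>2\<close> be the inverses of the marginal \<open>F\<close>-transforms. Letting one variable tend to
  infinity in the Levy-Khintchine formula isolates the marginal transforms
  (\<open>marginal_exponent\<close>), and subtracting them leaves a formula for
  \<open>G\<^sub>\<mu>(g\<^sub>1 z, g\<^sub>2 w)\<close> alone (\<open>joint_eq\<close>):
  \<open>1 - 1/(z w G\<^sub>\<mu>(g\<^sub>1 z, g\<^sub>2 w)) = c/(z w) + \<integral> (s/(z - s)) (t/(w - t)) d\<tau>\<close>.
  Moreover \<open>Im (g\<^sub>i(iy)) = y (1 - Q\<^sub>i(y))\<close>, where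
  \<open>Q\<^sub>i(y) = A\<^sub>i\<^sub>i/y\<^sup>2 + \<integral> x\<^sub>i\<^sup>2/(y\<^sup>2 + x\<^sub>i\<^sup>2) d\<tau>\<close>; both terms of \<open>Q\<^sub>i\<close> are non-negative.

  Consider a line \<open>t = k s + d\<close> with \<open>k \<noteq> 0\<close>, and write \<open>(X, Y)\<close> for a vector with law \<open>\<mu>\<close>.
  The idea is to use \<open>z = iy\<close> and \<open>w = -iky\<close>, the conjugate of \<open>k z\<close>. As soon as
  \<open>g\<^sub>2(iky) = k g\<^sub>1(iy) + d\<close>, the joint formula at this pair computes the inner product of
  \<open>1/(g\<^sub>1(iy) - X)\<close> and \<open>k/(g\<^sub>2(iky) - Y)\<close> in \<open>L\<^sup>2(\<mu>)\<close> in terms of the inner product of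
  \<open>s/(iy - s)\<close> and \<open>t/(iky - t)\<close> in \<open>L\<^sup>2(\<tau>)\<close>. The marginals give the norms of these four
  functions, in \<open>L\<^sup>2(\<tau>)\<close> after the contribution of \<open>A\<close> is split off.

  If \<open>\<tau>\<close> lives on \<open>t = k s\<close> and \<open>(-k, 1)\<close> is in the kernel of \<open>A\<close>, then the relation between
  \<open>g\<^sub>1\<close> and \<open>g\<^sub>2\<close> is read off from the formula, with \<open>d = v\<^sub>2 - k v\<^sub>1\<close>, and the inner product
  in \<open>L\<^sup>2(\<mu>)\<close> equals the square of both norms. Hence the two functions agree and
  \<open>Y = k X + d\<close> almost surely (\<open>law_on_line_if_levy_on_line\<close>).

  Conversely, if \<open>Y = k X + d\<close> almost surely, then the relation between \<open>g\<^sub>1\<close> and \<open>g\<^sub>2\<close> follows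
  for large \<open>y\<close> from the uniqueness of the asymptotic inverse
  (\<open>asymptotic_inverse_unique\<close>), and the squared distance of the two functions in \<open>L\<^sup>2(\<tau>)\<close>
  comes out as \<open>- q/y\<^sup>2\<close>, where \<open>q \<ge> 0\<close> is a value of the quadratic form of \<open>A\<close>. So both vanish
  (\<open>levy_on_line_if_law_on_line\<close>).

  Lines parallel to an axis concern a single marginal and are treated in the same way,
  with a constant in place of the second function.
\<close>

section \<open>Equality in mean square\<close>

lemma mean_square_distance:
  fixes f g :: "'a \<Rightarrow> complex"
  assumes [measurable]: "f \<in> borel_measurable M" "g \<in> borel_measurable M"
    and f2: "integrable M (\<lambda>x. (cmod (f x))\<^sup>2)" and g2: "integrable M (\<lambda>x. (cmod (g x))\<^sup>2)"
  shows "integrable M (\<lambda>x. f x * cnj (g x))"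
    and "integrable M (\<lambda>x. (cmod (f x - g x))\<^sup>2)"
    and "(\<integral>x. (cmod (f x - g x))\<^sup>2 \<partial>M) =
      (\<integral>x. (cmod (f x))\<^sup>2 \<partial>M) + (\<integral>x. (cmod (g x))\<^sup>2 \<partial>M)
        - 2 * Re (\<integral>x. f x * cnj (g x) \<partial>M)"
proof -
  show fg: "integrable M (\<lambda>x. f x * cnj (g x))"
  proof (rule Bochner_Integration.integrable_bound)
    show "integrable M (\<lambda>x. (cmod (f x))\<^sup>2 + (cmod (g x))\<^sup>2)" using f2 g2 by simp
    have "cmod (f x) * cmod (g x) \<le> (cmod (f x))\<^sup>2 + (cmod (g x))\<^sup>2" for x
      using sum_squares_bound[of "cmod (f x)" "cmod (g x)"]
        mult_nonneg_nonneg[OF norm_ge_zero[of "f x"] norm_ge_zero[of "g x"]] by linarith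
    then show "AE x in M. norm (f x * cnj (g x)) \<le> norm ((cmod (f x))\<^sup>2 + (cmod (g x))\<^sup>2)"
      by (simp add: norm_mult)
    have [measurable]: "cnj \<in> borel_measurable borel"
      by (intro borel_measurable_continuous_onI continuous_intros)
    show "(\<lambda>x. f x * cnj (g x)) \<in> borel_measurable M" by measurable
  qed
  have eq: "(cmod (f x - g x))\<^sup>2 = (cmod (f x))\<^sup>2 + (cmod (g x))\<^sup>2 - 2 * Re (f x * cnj (g x))" for x
    unfolding cmod_power2 by (simp add: algebra_simps power2_eq_square)
  show "integrable M (\<lambda>x. (cmod (f x - g x))\<^sup>2)"
    unfolding eq using f2 g2 fg
    by (intro Bochner_Integration.integrable_add Bochner_Integration.integrable_diff
        integrable_mult_right integrable_Re)
  show "(\<integral>x. (cmod (f x - g x))\<^sup>2 \<partial>M) =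
      (\<integral>x. (cmod (f x))\<^sup>2 \<partial>M) + (\<integral>x. (cmod (g x))\<^sup>2 \<partial>M)
        - 2 * Re (\<integral>x. f x * cnj (g x) \<partial>M)"
    unfolding eq integral_Re[OF fg, symmetric] using f2 g2 fg
    by (simp del: times_complex.sel integral_Re)
qed

text \<open>
  The equality case of the Cauchy-Schwarz inequality, in the form in which every almost-everywhere
  identity below is obtained: two norms and an inner product are computed separately and turn out
  to leave no room for a distance.
\<close>

lemma AE_eq_if_mean_square_distance_nonpos:
  fixes f g :: "'a \<Rightarrow> complex"
  assumes "f \<in> borel_measurable M" "g \<in> borel_measurable M"
    and "integrable M (\<lambda>x. (cmod (f x))\<^sup>2)" "integrable M (\<lambda>x. (cmod (g x))\<^sup>2)"
    and le: "(\<integral>x. (cmod (f x))\<^sup>2 \<partial>M) + (\<integral>x. (cmod (g x))\<^sup>2 \<partial>M)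
        - 2 * Re (\<integral>x. f x * cnj (g x) \<partial>M) \<le> 0"
  shows "AE x in M. f x = g x"
proof -
  note d = mean_square_distance[OF assms(1-4)]
  have "(\<integral>x. (cmod (f x - g x))\<^sup>2 \<partial>M) = 0"
    using le d(3) by (intro antisym integral_nonneg_AE) auto
  then have "AE x in M. (cmod (f x - g x))\<^sup>2 = 0"
    using integral_nonneg_eq_0_iff_AE[OF d(2)] by simp
  then show ?thesis by simp
qed

section \<open>Planar vectors, semi-definite matrices and supports\<close>

lemma norm_sq_vec2: "(norm x)\<^sup>2 = (x $ 1)\<^sup>2 + (x $ 2)\<^sup>2" for x :: "real^2"
  by (simp add: norm_vec_def L2_set_def sum_2)

lemma component_sq_le: "(x $ i)\<^sup>2 \<le> (norm x)\<^sup>2" for x :: "real^'n"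
  using component_le_norm_cart[of x i] by (metis abs_ge_zero power2_abs power_mono)

lemma inner_vec2: "u \<bullet> x = u $ 1 * x $ 1 + u $ 2 * x $ 2" for u x :: "real^2"
  by (simp add: inner_vec_def sum_2)

lemma matrix_vector_mult_2: "(A *v u) $ i = A $ i $ 1 * u $ 1 + A $ i $ 2 * u $ 2" for A :: "real^2^2"
  by (simp add: matrix_vector_mult_def sum_2)

lemma pos_semidef_symmetric: "pos_semidef A \<Longrightarrow> A $ i $ j = A $ j $ i"
proof -
  assume "pos_semidef A"
  then have "transpose A $ j $ i = A $ j $ i" by (simp add: pos_semidef_def)
  then show ?thesis by (simp add: transpose_def)
qed

text \<open>
  A zero of a non-negative quadratic form is a minimum, so the gradient \<open>2 A u\<close> vanishes there.
  Explicitly, moving from \<open>u\<close> a short way against \<open>A u\<close> would make the form negative.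
\<close>

lemma pos_semidef_quadratic_zero:
  fixes A :: "real^'n^'n"
  assumes A: "pos_semidef A" and u: "u \<bullet> (A *v u) = 0"
  shows "A *v u = 0"
proof -
  define w where "w = A *v u"
  define K where "K = w \<bullet> (A *v w)"
  have sym: "u \<bullet> (A *v w) = w \<bullet> w"
    using A unfolding pos_semidef_def w_def
    by (metis dot_lmul_matrix transpose_matrix_vector)
  have K: "K \<ge> 0" using A by (simp add: K_def pos_semidef_def)
  have *: "0 \<le> - 2 * t * (w \<bullet> w) + t\<^sup>2 * K" for t
  proof -
    have "0 \<le> (u - t *\<^sub>R w) \<bullet> (A *v (u - t *\<^sub>R w))"
      using A by (simp add: pos_semidef_def)
    also have "A *v (u - t *\<^sub>R w) = w - t *\<^sub>R (A *v w)"
      by (simp add: w_def matrix_vector_mult_diff_distrib matrix_vector_mult_scaleR)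
    also have "(u - t *\<^sub>R w) \<bullet> (w - t *\<^sub>R (A *v w)) = - 2 * t * (w \<bullet> w) + t\<^sup>2 * K"
      using u sym by (simp add: K_def inner_diff w_def[symmetric] algebra_simps power2_eq_square)
    finally show ?thesis .
  qed
  have "w \<bullet> w = 0"
  proof (rule ccontr)
    assume "w \<bullet> w \<noteq> 0"
    then have p: "w \<bullet> w > 0" by simp
    \<comment> \<open>The minimiser of the bound would be \<open>(w \<bullet> w) / K\<close>; adding 1 keeps the denominator positive.\<close>
    define t where "t = (w \<bullet> w) / (K + 1)"
    have "t * (K + 1) = w \<bullet> w" using K by (simp add: t_def)
    then have "- 2 * t * (w \<bullet> w) + t\<^sup>2 * K = - t\<^sup>2 * (K + 2)"
      by (simp add: power2_eq_square algebra_simps flip: \<open>t * (K + 1) = w \<bullet> w\<close>)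
    moreover have "t > 0" using p K by (simp add: t_def)
    ultimately show False using *[of t] K
      by (smt (verit) mult_pos_pos mult_minus_left zero_less_power)
  qed
  then show ?thesis by (simp add: w_def)
qed

lemma supported_on_iff_AE:
  fixes S :: "'a::topological_space set"
  assumes "sets M = sets borel" "closed S"
  shows "supported_on M S \<longleftrightarrow> (AE x in M. x \<in> S)"
proof -
  have [measurable]: "S \<in> sets M" using assms by simp
  have sp: "space M = UNIV" using assms(1) by (metis sets_eq_imp_space_eq space_borel)
  have "(AE x in M. x \<in> S) \<longleftrightarrow> {x\<in>space M. x \<notin> S} \<in> null_sets M"
    by (rule AE_iff_null) measurable
  also have "{x\<in>space M. x \<notin> S} = - S" using sp by auto
  finally show ?thesis
    using assms by (auto simp: supported_on_def null_sets_def)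
qed

section \<open>Resolvents on the imaginary axis\<close>

abbreviation im_axis :: "real \<Rightarrow> complex" where
  "im_axis y \<equiv> \<i> * complex_of_real y"

lemma norm_le_im_axis_minus:
  fixes y r :: real
  shows "\<bar>y\<bar> \<le> cmod (im_axis y - r)" "\<bar>r\<bar> \<le> cmod (im_axis y - r)"
    and "(cmod (im_axis y - r))\<^sup>2 = y\<^sup>2 + r\<^sup>2"
proof -
  have "Im (im_axis y - r) = y" and Re: "Re (im_axis y - r) = - r" by simp_all
  then show "\<bar>y\<bar> \<le> cmod (im_axis y - r)" by (metis abs_Im_le_cmod)
  show "\<bar>r\<bar> \<le> cmod (im_axis y - r)" by (metis Re abs_Re_le_cmod abs_minus_cancel)
  show "(cmod (im_axis y - r))\<^sup>2 = y\<^sup>2 + r\<^sup>2" by (simp add: cmod_power2)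
qed

lemma im_axis_minus_nonzero: "y \<noteq> 0 \<Longrightarrow> im_axis y - complex_of_real r \<noteq> 0"
  by (auto simp: complex_eq_iff)

lemma im_axis_mult: "im_axis a * im_axis b = complex_of_real (- (a * b))"
  by (simp add: complex_eq_iff)

lemma norm_resolvent_le:
  assumes "1 \<le> \<bar>y\<bar>"
  shows "cmod (r / (im_axis y - r)) \<le> min 1 \<bar>r\<bar>"
proof -
  have "cmod (im_axis y - r) \<ge> 1"
    using norm_le_im_axis_minus(1)[of y r] assms by linarith
  moreover have "\<bar>r\<bar> \<le> cmod (im_axis y - r)"
    by (rule norm_le_im_axis_minus(2))
  moreover have "\<bar>r\<bar> / cmod (im_axis y - r) \<le> \<bar>r\<bar> / 1"
    using calculation by (intro divide_left_mono) auto
  ultimately show ?thesis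
    by (simp add: norm_divide divide_le_eq_1 del: of_real_divide)
qed

section \<open>Cauchy transforms and uniqueness of the asymptotic inverse\<close>

lemma norm_cauchy_kernel_le:
  assumes "z \<notin> \<real>"
  shows "cmod (1 / (z - complex_of_real r)) \<le> 1 / \<bar>Im z\<bar>"
proof -
  have "Im z \<noteq> 0" using assms complex_is_Real_iff by blast
  then show ?thesis
    using abs_Im_le_cmod[of "z - r"] by (auto simp: norm_divide intro!: frac_le)
qed

lemma integrable_cauchy_kernel:
  assumes "finite_measure M" "z \<notin> \<real>" and [measurable]: "X \<in> borel_measurable M"
  shows "integrable M (\<lambda>x. 1 / (z - complex_of_real (X x)))"
    and "integrable M (\<lambda>x. (cmod (1 / (z - complex_of_real (X x))))\<^sup>2)"
proof -
  note b = norm_cauchy_kernel_le[OF assms(2)]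
  show "integrable M (\<lambda>x. 1 / (z - complex_of_real (X x)))"
    by (rule finite_measure.integrable_const_bound[OF assms(1), where B = "1 / \<bar>Im z\<bar>"])
      (use b in auto)
  show "integrable M (\<lambda>x. (cmod (1 / (z - complex_of_real (X x))))\<^sup>2)"
    by (rule finite_measure.integrable_const_bound[OF assms(1), where B = "(1 / \<bar>Im z\<bar>)\<^sup>2"])
      (use b in \<open>auto intro!: AE_I2 power_mono simp del: power_divide\<close>)
qed

text \<open>
  Pointwise, \<open>Im (1/(z - r)) = - Im z / |z - r|\<^sup>2\<close>, so the Cauchy transform at \<open>z\<close> already knows
  the \<open>L\<^sup>2\<close> norm of the kernel.
\<close>
lemma integral_norm_cauchy_kernel_sq:
  assumes M: "finite_measure M" and z: "z \<notin> \<real>" and X: "X \<in> borel_measurable M"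
  shows "(\<integral>x. (cmod (1 / (z - complex_of_real (X x))))\<^sup>2 \<partial>M) =
    - Im (\<integral>x. 1 / (z - complex_of_real (X x)) \<partial>M) / Im z"
proof -
  have Im: "Im z \<noteq> 0" using z complex_is_Real_iff by blast
  have "(cmod (1 / (z - complex_of_real (X x))))\<^sup>2 = - Im (1 / (z - complex_of_real (X x))) / Im z" for x
    using Im unfolding norm_divide power_divide cmod_power2 by (simp add: Im_divide)
  then show ?thesis
    using integrable_cauchy_kernel(1)[OF assms] by simp
qed

text \<open>
  Near the imaginary axis the imaginary part of \<open>\<zeta> y\<close> is comparable to its modulus, which gives a
  bound that is uniform in the pole \<open>r\<close> and hence suitable for dominated convergence.
\<close>
lemma asymptotic_resolvent:
  fixes \<zeta> :: "real \<Rightarrow> complex" and c :: real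
  assumes lim: "((\<lambda>y. \<zeta> y / im_axis (c * y)) \<longlongrightarrow> 1) at_top" and c: "c \<noteq> 0"
  shows "((\<lambda>y. im_axis (c * y) / (\<zeta> y - complex_of_real r)) \<longlongrightarrow> 1) at_top"
    and "eventually (\<lambda>y. \<forall>r. cmod (im_axis (c * y) / (\<zeta> y - complex_of_real r)) \<le> 2) at_top"
proof -
  have "((\<lambda>y. complex_of_real r * (1 / (\<i> * of_real c)) * of_real (inverse y)) \<longlongrightarrow> complex_of_real r * (1 / (\<i> * of_real c)) * of_real 0) at_top"
    by (intro tendsto_intros tendsto_inverse_0_at_top filterlim_ident)
  then have "((\<lambda>y. complex_of_real r / im_axis (c * y)) \<longlongrightarrow> 0) at_top"
    by (simp add: field_simps)
  from tendsto_diff[OF lim this]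
  have "((\<lambda>y. (\<zeta> y - r) / im_axis (c * y)) \<longlongrightarrow> 1) at_top"
    by (simp add: diff_divide_distrib)
  from tendsto_inverse[OF this]
  show "((\<lambda>y. im_axis (c * y) / (\<zeta> y - complex_of_real r)) \<longlongrightarrow> 1) at_top"
    by simp
  have "eventually (\<lambda>y. dist (\<zeta> y / im_axis (c * y)) 1 < 1 / 2) at_top"
    by (rule tendstoD[OF lim]) simp
  then show "eventually (\<lambda>y. \<forall>r. cmod (im_axis (c * y) / (\<zeta> y - complex_of_real r)) \<le> 2) at_top"
    using eventually_gt_at_top[of 0]
  proof eventually_elim
    case (elim y)
    have cy: "c * y \<noteq> 0" using elim c by simp
    have "\<bar>Re (\<zeta> y / im_axis (c * y) - 1)\<bar> < 1 / 2"
      using elim(1) abs_Re_le_cmod order_le_less_trans unfolding dist_norm by blast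
    moreover have "Re (\<zeta> y / im_axis (c * y) - 1) = Im (\<zeta> y) / (c * y) - 1"
      using cy by (simp add: Re_divide power2_eq_square)
    ultimately have "1 / 2 \<le> \<bar>Im (\<zeta> y) / (c * y)\<bar>" by linarith
    then have Im: "\<bar>c * y\<bar> \<le> 2 * \<bar>Im (\<zeta> y)\<bar>"
      using cy by (simp add: field_simps abs_mult)
    show ?case
    proof
      fix r
      have "\<bar>Im (\<zeta> y)\<bar> \<le> cmod (\<zeta> y - complex_of_real r)"
        using abs_Im_le_cmod[of "\<zeta> y - complex_of_real r"] by simp
      with Im have "\<bar>c * y\<bar> \<le> 2 * cmod (\<zeta> y - complex_of_real r)" by linarith
      moreover have "0 < \<bar>c * y\<bar>" using cy by simp
      ultimately show "cmod (im_axis (c * y) / (\<zeta> y - complex_of_real r)) \<le> 2"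
        by (simp add: norm_divide norm_mult abs_mult divide_le_eq)
    qed
  qed
qed

lemma (in prob_space) integral_resolvent_limit:
  fixes p :: "'a \<Rightarrow> complex" and X :: "'a \<Rightarrow> real" and \<zeta> :: "real \<Rightarrow> complex"
  assumes lim: "((\<lambda>y. \<zeta> y / im_axis (c * y)) \<longlongrightarrow> 1) at_top" and c: "c \<noteq> 0"
    and [measurable]: "p \<in> borel_measurable M" "X \<in> borel_measurable M"
    and B: "\<And>x. cmod (p x) \<le> B"
  shows "((\<lambda>y. \<integral>x. p x * (im_axis (c * y) / (\<zeta> y - X x)) \<partial>M) \<longlongrightarrow> (\<integral>x. p x \<partial>M)) at_top"
proof (rule integral_dominated_convergence_at_top[where w = "\<lambda>_. B * 2"])
  show "AE x in M. ((\<lambda>y. p x * (im_axis (c * y) / (\<zeta> y - X x))) \<longlongrightarrow> p x) at_top"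
    using tendsto_mult[OF tendsto_const asymptotic_resolvent(1)[OF lim c]] by fastforce
  have "B \<ge> 0" using B norm_ge_zero order_trans by blast
  show "eventually (\<lambda>y. AE x in M. norm (p x * (im_axis (c * y) / (\<zeta> y - X x))) \<le> B * 2) at_top"
    using asymptotic_resolvent(2)[OF lim c]
    by eventually_elim
      (intro AE_I2, unfold norm_mult[of "p _"], intro mult_mono B, auto simp: \<open>B \<ge> 0\<close>)
qed measurable

text \<open>
  Two points \<open>\<zeta> \<noteq> \<xi>\<close> with \<open>G(\<zeta>) = G(\<xi>)\<close> satisfy \<open>\<integral> 1/((\<zeta> - X) (\<xi> - X)) = 0\<close>, since the
  difference of the two Cauchy kernels has the factor \<open>\<xi> - \<zeta>\<close>. After multiplication by
  \<open>(icy)\<^sup>2\<close> this integral tends to 1, so the two points must agree eventually.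
\<close>

lemma (in prob_space) asymptotic_inverse_unique:
  fixes X :: "'a \<Rightarrow> real" and \<zeta> \<xi> :: "real \<Rightarrow> complex"
  assumes lim: "((\<lambda>y. \<zeta> y / im_axis (c * y)) \<longlongrightarrow> 1) at_top" "((\<lambda>y. \<xi> y / im_axis (c * y)) \<longlongrightarrow> 1) at_top"
    and c: "c \<noteq> 0" and [measurable]: "X \<in> borel_measurable M"
    and nonreal: "eventually (\<lambda>y. \<zeta> y \<notin> \<real> \<and> \<xi> y \<notin> \<real>) at_top"
    and eq: "eventually (\<lambda>y. (\<integral>x. 1 / (\<zeta> y - X x) \<partial>M) = (\<integral>x. 1 / (\<xi> y - X x) \<partial>M)) at_top"
  shows "eventually (\<lambda>y. \<zeta> y = \<xi> y) at_top"
proof -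
  define q where "q \<zeta> y x = im_axis (c * y) / (\<zeta> y - X x)" for \<zeta> :: "real \<Rightarrow> complex" and y x
  have [measurable]: "q \<zeta> y \<in> borel_measurable M" for \<zeta> y unfolding q_def by measurable
  have "((\<lambda>y. \<integral>x. q \<zeta> y x * q \<xi> y x \<partial>M) \<longlongrightarrow> (\<integral>x. 1 \<partial>M)) at_top"
  proof (rule integral_dominated_convergence_at_top[where w = "\<lambda>_. 2 * 2"])
    show "AE x in M. ((\<lambda>y. q \<zeta> y x * q \<xi> y x) \<longlongrightarrow> 1) at_top"
      unfolding q_def
      using tendsto_mult[OF asymptotic_resolvent(1)[OF lim(1) c] asymptotic_resolvent(1)[OF lim(2) c]]
      by simp
    show "eventually (\<lambda>y. AE x in M. norm (q \<zeta> y x * q \<xi> y x) \<le> 2 * 2) at_top"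
      using asymptotic_resolvent(2)[OF lim(1) c] asymptotic_resolvent(2)[OF lim(2) c]
      by eventually_elim (intro AE_I2, unfold norm_mult q_def, intro mult_mono, auto)
  qed measurable
  then have "((\<lambda>y. \<integral>x. q \<zeta> y x * q \<xi> y x \<partial>M) \<longlongrightarrow> 1) at_top" by (simp add: prob_space)
  then have "eventually (\<lambda>y. (\<integral>x. q \<zeta> y x * q \<xi> y x \<partial>M) \<noteq> 0) at_top"
    by (rule tendsto_imp_eventually_ne) simp
  then show ?thesis using nonreal eq
  proof eventually_elim
    case (elim y)
    have nz: "\<zeta> y - X x \<noteq> 0" "\<xi> y - X x \<noteq> 0" for x
      using elim by (metis Reals_of_real eq_iff_diff_eq_0)+
    have int: "integrable M (\<lambda>x. 1 / (a - X x))" if "a \<notin> \<real>" for a :: complex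
      using that by (intro integrable_cauchy_kernel(1) finite_measure_axioms) measurable
    have "q \<zeta> y x * q \<xi> y x * (\<xi> y - \<zeta> y) =
        (im_axis (c * y))\<^sup>2 * (1 / (\<zeta> y - X x) - 1 / (\<xi> y - X x))" for x
    proof -
      have "Z / a * (Z / b) * (b - a) = Z\<^sup>2 * (1 / a - 1 / b)" if "a \<noteq> 0" "b \<noteq> 0" for a b Z :: complex
        using that by (simp add: field_simps power2_eq_square)
      from this[OF nz(1)[of x] nz(2)[of x], of "im_axis (c * y)"] show ?thesis by (simp add: q_def)
    qed
    then have "(\<integral>x. q \<zeta> y x * q \<xi> y x * (\<xi> y - \<zeta> y) \<partial>M) =
        (\<integral>x. (im_axis (c * y))\<^sup>2 * (1 / (\<zeta> y - X x) - 1 / (\<xi> y - X x)) \<partial>M)"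
      by presburger
    also have "\<dots> = 0" using elim int by (simp del: integral_mult_right_zero integral_divide_zero)
    finally show ?case using elim by simp
  qed
qed

section \<open>The Levy-Khintchine integrand\<close>

text \<open>
  The contribution of one coordinate \<open>r\<close> to the Levy-Khintchine integrand; \<open>q\<close> stands for the
  squared norm of the whole vector, which enters through the centering term.
\<close>

definition levy_kernel :: "real \<Rightarrow> real \<Rightarrow> complex \<Rightarrow> complex" where
  "levy_kernel r q z = r / (z - r) - r / (z * (1 + q))"

text \<open>
  The centering cancels the first-order term \<open>r/z\<close> up to the factor \<open>q/(1 + q)\<close>, and the remainder
  is of second order in \<open>r\<close>. This is what makes the kernel integrable against a Levy measure.
\<close>

lemma norm_levy_kernel_le:
  assumes y: "1 \<le> \<bar>y\<bar>" and r: "r\<^sup>2 \<le> q"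
  shows "cmod (levy_kernel r q (im_axis y)) \<le> 2 * min 1 q"
proof -
  have q: "q \<ge> 0" using r by (meson order_trans zero_le_power2)
  have y0: "y \<noteq> 0" using y by auto
  let ?z = "im_axis y"
  have nz: "?z - r \<noteq> 0" "complex_of_real (1 + q) \<noteq> 0" "?z \<noteq> 0"
    using im_axis_minus_nonzero[OF y0] y0 q by (simp_all only: of_real_eq_0_iff) auto
  have "levy_kernel r q ?z =
      r / (?z - r) * of_real (q / (1 + q)) + of_real (r\<^sup>2 / (1 + q)) / (?z * (?z - r))"
  proof -
    define c where "c = complex_of_real (1 + q)"
    have c: "c \<noteq> 0" "complex_of_real q = c - 1" using nz by (simp_all add: c_def)
    show ?thesis
      using nz c(1) unfolding levy_kernel_def of_real_divide c_def[symmetric] of_real_power c(2)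
      by (simp add: divide_simps) (simp add: algebra_simps power2_eq_square)
  qed
  also have "cmod \<dots> \<le> 1 * (q / (1 + q)) + q / (1 + q)"
  proof (rule order_trans[OF norm_triangle_ineq add_mono])
    show "cmod (r / (?z - r) * of_real (q / (1 + q))) \<le> 1 * (q / (1 + q))"
      using norm_resolvent_le[OF y, of r] q unfolding norm_mult norm_of_real
      by (intro mult_mono) auto
    have "1 \<le> cmod (?z * (?z - r))"
      using norm_le_im_axis_minus(1)[of y r] y unfolding norm_mult
      by (metis (no_types, opaque_lifting) abs_mult_self_eq mult_mono' norm_ii norm_mult norm_of_real
          mult_1 order_trans zero_le_one)
    then have "cmod (of_real (r\<^sup>2 / (1 + q)) / (?z * (?z - r))) \<le> (r\<^sup>2 / (1 + q)) / 1"
      unfolding norm_divide norm_of_real using q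
      by (intro frac_le) auto
    also have "\<dots> \<le> q / (1 + q)" using r q by (simp add: divide_right_mono)
    finally show "cmod (of_real (r\<^sup>2 / (1 + q)) / (?z * (?z - r))) \<le> q / (1 + q)" .
  qed
  also have "\<dots> \<le> 2 * min 1 q"
  proof -
    have "q / (1 + q) \<le> 1" "q / (1 + q) \<le> q" using q by (simp_all add: field_simps)
    then show ?thesis by simp
  qed
  finally show ?thesis .
qed

lemma Re_levy_kernel:
  "y \<noteq> 0 \<Longrightarrow> Re (levy_kernel r q (im_axis y)) = - (r\<^sup>2 / (y\<^sup>2 + r\<^sup>2))"
  unfolding levy_kernel_def
  by (simp add: Re_divide power2_eq_square add.commute)

lemma levy_kernel_cnj: "levy_kernel r q (cnj z) = cnj (levy_kernel r q z)"
  by (simp add: levy_kernel_def)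

text \<open>
  The kernel is homogeneous of degree 0 in \<open>(r, z)\<close>, so a Levy measure on the line \<open>t = k s\<close>
  gives the second marginal at \<open>k z\<close> the same integral as the first at \<open>z\<close>.
\<close>

lemma levy_kernel_scale:
  "k \<noteq> 0 \<Longrightarrow> levy_kernel (k * r) q (of_real k * z) = levy_kernel r q z"
proof -
  assume "k \<noteq> 0"
  moreover have "of_real k * z - of_real (k * r) = of_real k * (z - of_real r)"
    by (simp add: algebra_simps)
  ultimately show ?thesis by (simp add: levy_kernel_def)
qed

text \<open>
  With \<open>z/(z - s) = 1 + s/(z - s)\<close>, expanding the product of the two factors produces the
  two one-variable kernels and a product term that tends to 0 in each variable.
\<close>
lemma bifree_kernel_split:
  fixes s t q :: real and z w :: complex
  assumes "z \<noteq> 0" "w \<noteq> 0" "z \<noteq> s" "w \<noteq> t"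
  shows "z * w / ((z - s) * (w - t)) - 1 - (s / z + t / w) / of_real (1 + q) =
    levy_kernel s q z + levy_kernel t q w + (s / (z - s)) * (t / (w - t))"
proof -
  have a: "z / (z - s) = 1 + s / (z - s)" "w / (w - t) = 1 + t / (w - t)"
    using assms by (simp_all add: field_simps)
  have "z * w / ((z - s) * (w - t)) = (z / (z - s)) * (w / (w - t))" by simp
  then show ?thesis unfolding a levy_kernel_def
    by (simp add: algebra_simps add_divide_distrib)
qed

text \<open>
  The part of the Levy-Khintchine formula that depends on the variable of one coordinate only. It
  will turn out to be \<open>\<phi>(z)/z\<close> for the \<open>\<phi>\<close>-transform of that marginal.
\<close>

definition levy_exponent :: "real^2 \<Rightarrow> real^2^2 \<Rightarrow> (real^2) measure \<Rightarrow> 2 \<Rightarrow> complex \<Rightarrow> complex" where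
  "levy_exponent v A \<tau> i z = complex_of_real (v $ i) / z + complex_of_real (A $ i $ i) / z\<^sup>2
     + (\<integral>x. levy_kernel (x $ i) ((norm x)\<^sup>2) z \<partial>\<tau>)"

definition levy_coupling :: "real^2^2 \<Rightarrow> (real^2) measure \<Rightarrow> complex \<Rightarrow> complex \<Rightarrow> complex" where
  "levy_coupling A \<tau> z w = complex_of_real (A $ 1 $ 2) / (z * w)
     + (\<integral>x. (complex_of_real (x $ 1) / (z - complex_of_real (x $ 1)))
          * (complex_of_real (x $ 2) / (w - complex_of_real (x $ 2))) \<partial>\<tau>)"

text \<open>
  The quantity by which the map \<open>y \<mapsto> Im (g\<^sub>i(iy))\<close> falls short of the identity, relative to \<open>y\<close>.
\<close>

definition levy_variance :: "real^2^2 \<Rightarrow> (real^2) measure \<Rightarrow> 2 \<Rightarrow> real \<Rightarrow> real" where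
  "levy_variance A \<tau> i y = A $ i $ i / y\<^sup>2 + (\<integral>x. (x $ i)\<^sup>2 / (y\<^sup>2 + (x $ i)\<^sup>2) \<partial>\<tau>)"

locale levy_measure =
  fixes \<tau> :: "(real^2) measure"
  assumes sets_levy [measurable_cong, simp]: "sets \<tau> = sets borel"
    and levy_integrable: "integrable \<tau> (\<lambda>x. min 1 ((norm x)\<^sup>2))"
begin

lemma integrable_levy_kernel:
  assumes "1 \<le> \<bar>y\<bar>"
  shows "integrable \<tau> (\<lambda>x. levy_kernel (x $ i) ((norm x)\<^sup>2) (im_axis y))"
proof (rule Bochner_Integration.integrable_bound)
  show "integrable \<tau> (\<lambda>x. 2 * min 1 ((norm x)\<^sup>2))" using levy_integrable by simp
  show "AE x in \<tau>. norm (levy_kernel (x $ i) ((norm x)\<^sup>2) (im_axis y)) \<le> norm (2 * min 1 ((norm x)\<^sup>2))"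
    using norm_levy_kernel_le[OF assms component_sq_le] by (intro AE_I2) fastforce
qed (unfold levy_kernel_def, measurable)

lemma norm_resolvent_mult_le:
  fixes x :: "real^2"
  assumes "1 \<le> \<bar>y\<bar>" "1 \<le> \<bar>y'\<bar>"
  shows "cmod ((x $ i / (im_axis y - x $ i)) * (x $ j / (im_axis y' - x $ j))) \<le> min 1 ((norm x)\<^sup>2)"
proof -
  have "cmod ((x $ i / (im_axis y - x $ i)) * (x $ j / (im_axis y' - x $ j)))
      \<le> min 1 \<bar>x $ i\<bar> * min 1 \<bar>x $ j\<bar>"
    unfolding norm_mult by (intro mult_mono norm_resolvent_le assms) auto
  also have "\<dots> \<le> min 1 (norm x) * min 1 (norm x)"
    using component_le_norm_cart[of x] by (intro mult_mono) (auto intro: min.coboundedI2)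
  also have "\<dots> \<le> min 1 ((norm x)\<^sup>2)"
    using mult_mono[of 1 "norm x" 1 "norm x"] by (auto simp: min_def power2_eq_square mult_le_one)
  finally show ?thesis .
qed

lemma integrable_resolvent_mult:
  assumes "1 \<le> \<bar>y\<bar>" "1 \<le> \<bar>y'\<bar>"
  shows "integrable \<tau> (\<lambda>x. (x $ i / (im_axis y - x $ i)) * (x $ j / (im_axis y' - x $ j)))"
proof (rule Bochner_Integration.integrable_bound[OF levy_integrable])
  show "AE x in \<tau>. norm ((x $ i / (im_axis y - x $ i)) * (x $ j / (im_axis y' - x $ j)))
      \<le> norm (min 1 ((norm x)\<^sup>2))"
    using norm_resolvent_mult_le[OF assms] by (intro AE_I2) fastforce
qed measurable

lemma integrable_norm_resolvent_sq:
  assumes "1 \<le> \<bar>y\<bar>"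
  shows "integrable \<tau> (\<lambda>x. (cmod (x $ i / (im_axis y - x $ i)))\<^sup>2)"
proof -
  have "integrable \<tau> (\<lambda>x. cmod ((x $ i / (im_axis y - x $ i)) * (x $ i / (im_axis y - x $ i))))"
    by (intro integrable_norm integrable_resolvent_mult assms)
  then show ?thesis unfolding norm_mult power2_eq_square .
qed

lemma norm_resolvent_sq:
  fixes r y :: real
  shows "(cmod (r / (im_axis y - r)))\<^sup>2 = r\<^sup>2 / (y\<^sup>2 + r\<^sup>2)"
  unfolding norm_divide power_divide norm_le_im_axis_minus(3) by simp

lemma levy_khintchine_split:
  assumes "1 \<le> \<bar>y\<bar>" "1 \<le> \<bar>y'\<bar>"
  shows "bifree_levy_khintchine v A \<tau> (im_axis y) (im_axis y') =
    levy_exponent v A \<tau> 1 (im_axis y) + levy_exponent v A \<tau> 2 (im_axis y')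
      + levy_coupling A \<tau> (im_axis y) (im_axis y')"
proof -
  have y: "y \<noteq> 0" "y' \<noteq> 0" using assms by auto
  let ?z = "im_axis y" and ?w = "im_axis y'"
  have "?z * ?w / ((?z - x $ 1) * (?w - x $ 2)) - 1
          - (x $ 1 / ?z + x $ 2 / ?w) / complex_of_real (1 + (x $ 1)\<^sup>2 + (x $ 2)\<^sup>2) =
      levy_kernel (x $ 1) ((norm x)\<^sup>2) ?z + levy_kernel (x $ 2) ((norm x)\<^sup>2) ?w
        + (x $ 1 / (?z - x $ 1)) * (x $ 2 / (?w - x $ 2))" for x :: "real^2"
  proof -
    have "?z \<noteq> 0" "?w \<noteq> 0" "?z \<noteq> x $ 1" "?w \<noteq> x $ 2"
      using im_axis_minus_nonzero[OF y(1), of "x $ 1"] im_axis_minus_nonzero[OF y(2), of "x $ 2"] y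
      by auto
    from bifree_kernel_split[OF this, of "(norm x)\<^sup>2"] show ?thesis
      by (simp only: norm_sq_vec2 add.assoc)
  qed
  then have "(\<integral>x. ?z * ?w / ((?z - x $ 1) * (?w - x $ 2)) - 1
          - (x $ 1 / ?z + x $ 2 / ?w) / complex_of_real (1 + (x $ 1)\<^sup>2 + (x $ 2)\<^sup>2) \<partial>\<tau>) =
      (\<integral>x. levy_kernel (x $ 1) ((norm x)\<^sup>2) ?z \<partial>\<tau>) + (\<integral>x. levy_kernel (x $ 2) ((norm x)\<^sup>2) ?w \<partial>\<tau>)
        + (\<integral>x. (x $ 1 / (?z - x $ 1)) * (x $ 2 / (?w - x $ 2)) \<partial>\<tau>)"
    using integrable_levy_kernel[OF assms(1)] integrable_levy_kernel[OF assms(2)]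
      integrable_resolvent_mult[OF assms]
    by (simp del: of_real_divide)
  then show ?thesis
    unfolding bifree_levy_khintchine_def levy_exponent_def levy_coupling_def
    by (simp only: add_ac)
qed

lemma resolvent_im_axis_tendsto_0:
  fixes r :: real
  shows "((\<lambda>y. r / (im_axis y - r)) \<longlongrightarrow> 0) at_top"
proof (rule Lim_null_comparison)
  show "((\<lambda>y. \<bar>r\<bar> * inverse y) \<longlongrightarrow> 0) at_top"
    by (intro tendsto_mult_right_zero tendsto_inverse_0_at_top filterlim_ident)
  show "eventually (\<lambda>y. cmod (r / (im_axis y - r)) \<le> \<bar>r\<bar> * inverse y) at_top"
    using eventually_gt_at_top[of 0]
  proof eventually_elim
    case (elim y)
    have "\<bar>r\<bar> / cmod (im_axis y - r) \<le> \<bar>r\<bar> / y"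
      using norm_le_im_axis_minus(1)[of y r] elim by (intro frac_le) auto
    then have "cmod (complex_of_real r / (im_axis y - complex_of_real r)) \<le> \<bar>r\<bar> / y"
      by (simp only: norm_divide norm_of_real)
    then show ?case by (simp only: divide_inverse[of "\<bar>r\<bar>" y])
  qed
qed

lemma inverse_im_axis_tendsto_0: "((\<lambda>y. a / im_axis y) \<longlongrightarrow> 0) at_top"
proof -
  have "((\<lambda>y. a * (1 / \<i>) * complex_of_real (inverse y)) \<longlongrightarrow> a * (1 / \<i>) * of_real 0) at_top"
    by (intro tendsto_intros tendsto_inverse_0_at_top filterlim_ident)
  then show ?thesis by (simp add: divide_inverse mult_ac)
qed

lemma levy_exponent_tendsto_0: "((\<lambda>y. levy_exponent v A \<tau> i (im_axis y)) \<longlongrightarrow> 0) at_top"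
proof -
  have k: "((\<lambda>y. levy_kernel r q (im_axis y)) \<longlongrightarrow> 0) at_top" for r q
    using tendsto_diff[OF resolvent_im_axis_tendsto_0[of r] inverse_im_axis_tendsto_0[of "r / (1 + q)"]]
    by (simp add: levy_kernel_def divide_simps mult_ac)
  have int: "((\<lambda>y. \<integral>x. levy_kernel (x $ i) ((norm x)\<^sup>2) (im_axis y) \<partial>\<tau>) \<longlongrightarrow> (\<integral>x. 0 \<partial>\<tau>)) at_top"
  proof (rule integral_dominated_convergence_at_top[where w = "\<lambda>x. 2 * min 1 ((norm x)\<^sup>2)"])
    show "eventually (\<lambda>y. AE x in \<tau>. norm (levy_kernel (x $ i) ((norm x)\<^sup>2) (im_axis y))
        \<le> 2 * min 1 ((norm x)\<^sup>2)) at_top"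
      using eventually_ge_at_top[of 1]
      by eventually_elim (intro AE_I2 norm_levy_kernel_le component_sq_le, simp)
    show "integrable \<tau> (\<lambda>x. 2 * min 1 ((norm x)\<^sup>2))" using levy_integrable by simp
    show "(\<lambda>x. levy_kernel (x $ i) ((norm x)\<^sup>2) (im_axis y)) \<in> borel_measurable \<tau>" for y
      unfolding levy_kernel_def by measurable
  qed (use k in auto)
  have sq: "((\<lambda>y. A $ i $ i / (im_axis y)\<^sup>2) \<longlongrightarrow> 0) at_top"
    using tendsto_mult[OF inverse_im_axis_tendsto_0[of "A $ i $ i"] inverse_im_axis_tendsto_0[of 1]]
    by (simp add: power2_eq_square)
  show ?thesis
    unfolding levy_exponent_def
    using tendsto_add[OF tendsto_add[OF inverse_im_axis_tendsto_0[of "v $ i"] sq] int] by simp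
qed

lemma levy_coupling_integral_tendsto_0:
  assumes "1 \<le> \<bar>y\<bar>"
  shows "((\<lambda>y'. \<integral>x. (x $ i / (im_axis y - x $ i)) * (x $ j / (im_axis y' - x $ j)) \<partial>\<tau>) \<longlongrightarrow> 0) at_top"
proof -
  have "((\<lambda>y'. \<integral>x. (x $ i / (im_axis y - x $ i)) * (x $ j / (im_axis y' - x $ j)) \<partial>\<tau>)
      \<longlongrightarrow> (\<integral>x. 0 \<partial>\<tau>)) at_top"
  proof (rule integral_dominated_convergence_at_top[where w = "\<lambda>x. min 1 ((norm x)\<^sup>2)"])
    show "eventually (\<lambda>y'. AE x in \<tau>. norm ((x $ i / (im_axis y - x $ i)) * (x $ j / (im_axis y' - x $ j)))
        \<le> min 1 ((norm x)\<^sup>2)) at_top"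
      using eventually_ge_at_top[of 1]
      by eventually_elim (intro AE_I2 norm_resolvent_mult_le assms, simp)
    show "AE x in \<tau>. ((\<lambda>y'. (x $ i / (im_axis y - x $ i)) * (x $ j / (im_axis y' - x $ j))) \<longlongrightarrow> 0) at_top"
      by (intro AE_I2 tendsto_mult_right_zero resolvent_im_axis_tendsto_0)
  qed (use levy_integrable in auto)
  then show ?thesis by simp
qed

lemma levy_coupling_tendsto_0:
  assumes "1 \<le> \<bar>y\<bar>"
  shows "((\<lambda>y'. levy_coupling A \<tau> (im_axis y) (im_axis y')) \<longlongrightarrow> 0) at_top"
    and "((\<lambda>y'. levy_coupling A \<tau> (im_axis y') (im_axis y)) \<longlongrightarrow> 0) at_top"
proof -
  have c: "((\<lambda>y'. (A $ 1 $ 2 / im_axis y) / im_axis y') \<longlongrightarrow> 0) at_top"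
    by (rule inverse_im_axis_tendsto_0)
  show "((\<lambda>y'. levy_coupling A \<tau> (im_axis y) (im_axis y')) \<longlongrightarrow> 0) at_top"
    unfolding levy_coupling_def
    using tendsto_add[OF c levy_coupling_integral_tendsto_0[OF assms, of 1 2]] by simp
  show "((\<lambda>y'. levy_coupling A \<tau> (im_axis y') (im_axis y)) \<longlongrightarrow> 0) at_top"
    unfolding levy_coupling_def
    using tendsto_add[OF c levy_coupling_integral_tendsto_0[OF assms, of 2 1]] by (simp add: mult_ac)
qed

lemma levy_exponent_cnj: "levy_exponent v A \<tau> i (cnj z) = cnj (levy_exponent v A \<tau> i z)"
  by (simp add: levy_exponent_def levy_kernel_cnj)

lemma Re_levy_exponent:
  assumes "1 \<le> \<bar>y\<bar>"
  shows "Re (levy_exponent v A \<tau> i (im_axis y)) = - levy_variance A \<tau> i y"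
proof -
  have y: "y \<noteq> 0" using assms by auto
  have "Re (\<integral>x. levy_kernel (x $ i) ((norm x)\<^sup>2) (im_axis y) \<partial>\<tau>) =
      (\<integral>x. Re (levy_kernel (x $ i) ((norm x)\<^sup>2) (im_axis y)) \<partial>\<tau>)"
    by (intro integral_Re[symmetric] integrable_levy_kernel assms)
  also have "\<dots> = - (\<integral>x. (x $ i)\<^sup>2 / (y\<^sup>2 + (x $ i)\<^sup>2) \<partial>\<tau>)"
    using y by (simp add: Re_levy_kernel)
  finally show ?thesis
    using y by (simp add: levy_exponent_def levy_variance_def Re_divide power2_eq_square power_mult_distrib)
qed

end

section \<open>Separating the marginals from the joint law\<close>

text \<open>
  What is used of the triplet of \<open>\<mu>\<close>: the inverses \<open>g\<^sub>i\<close> and the formula on the part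
  \<open>R \<le> |y|\<close> of the imaginary axis, which lies in the truncated cone. The scale \<open>c\<close> in the
  asymptotics covers both half-axes and the rescaling \<open>y \<mapsto> k y\<close>. On \<open>1 \<le> |y|\<close> all integrands
  with respect to \<open>\<tau>\<close> are dominated by \<open>2 min 1 |x|\<^sup>2\<close>, uniformly in \<open>y\<close>.
\<close>

locale bifree_levy_law = prob_space \<mu> + levy_measure \<tau>
  for \<mu> \<tau> :: "(real^2) measure" +
  fixes v :: "real^2" and A :: "real^2^2" and g :: "2 \<Rightarrow> complex \<Rightarrow> complex" and R :: real
  assumes sets_law [measurable_cong, simp]: "sets \<mu> = sets borel"
    and pos_semidef: "pos_semidef A"
    and R: "1 \<le> R"
    and nonreal: "\<And>i y. R \<le> \<bar>y\<bar> \<Longrightarrow> g i (im_axis y) \<notin> \<real>"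
    and cauchy_at_inverse:
      "\<And>i y. R \<le> \<bar>y\<bar> \<Longrightarrow> (\<integral>x. 1 / (g i (im_axis y) - complex_of_real (x $ i)) \<partial>\<mu>) = 1 / im_axis y"
    and asymptotic: "\<And>i c. c \<noteq> 0 \<Longrightarrow> ((\<lambda>y. g i (im_axis (c * y)) / im_axis (c * y)) \<longlongrightarrow> 1) at_top"
    and levy_khintchine: "\<And>y y'. R \<le> \<bar>y\<bar> \<Longrightarrow> R \<le> \<bar>y'\<bar> \<Longrightarrow>
      cauchy_G2 \<mu> (g 1 (im_axis y)) (g 2 (im_axis y')) \<noteq> 0 \<and>
      bifree_levy_khintchine v A \<tau> (im_axis y) (im_axis y') =
        (g 1 (im_axis y) - im_axis y) / im_axis y + (g 2 (im_axis y') - im_axis y') / im_axis y'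
        + 1 - 1 / (im_axis y * im_axis y' * cauchy_G2 \<mu> (g 1 (im_axis y)) (g 2 (im_axis y')))"
begin

lemma marginal_part_tendsto_0: "((\<lambda>y. (g i (im_axis y) - im_axis y) / im_axis y) \<longlongrightarrow> 0) at_top"
proof -
  have "((\<lambda>y. g i (im_axis y) / im_axis y - 1) \<longlongrightarrow> 1 - 1) at_top"
    using asymptotic[of 1 i] by (intro tendsto_intros) simp
  moreover have "eventually (\<lambda>y. g i (im_axis y) / im_axis y - 1 =
      (g i (im_axis y) - im_axis y) / im_axis y) at_top"
    using eventually_gt_at_top[of 0] by eventually_elim (simp add: diff_divide_distrib)
  ultimately show ?thesis by (simp add: tendsto_cong)
qed

text \<open>
  As \<open>w \<rightarrow> \<infinity>\<close>, \<open>w G\<^sub>\<mu>(g\<^sub>1 z, g\<^sub>2 w)\<close> tends to the Cauchy transform of the first marginal at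
  \<open>g\<^sub>1 z\<close>, which is \<open>1/z\<close>; symmetrically in the other variable.
\<close>

lemma joint_part_tendsto_0:
  assumes y: "R \<le> \<bar>y\<bar>"
  shows "((\<lambda>y'. 1 - 1 / (im_axis y * im_axis y' * cauchy_G2 \<mu> (g 1 (im_axis y)) (g 2 (im_axis y'))))
      \<longlongrightarrow> 0) at_top"
    and "((\<lambda>y'. 1 - 1 / (im_axis y' * im_axis y * cauchy_G2 \<mu> (g 1 (im_axis y')) (g 2 (im_axis y))))
      \<longlongrightarrow> 0) at_top"
proof -
  have y0: "im_axis y \<noteq> 0" using y R by auto
  have *: "((\<lambda>y'. 1 - 1 / (im_axis y * (\<integral>x. 1 / (g i (im_axis y) - complex_of_real (x $ i))
       * (im_axis y' / (g j (im_axis y') - complex_of_real (x $ j))) \<partial>\<mu>))) \<longlongrightarrow> 0) at_top" for i j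
  proof -
    have "((\<lambda>y'. \<integral>x. 1 / (g i (im_axis y) - complex_of_real (x $ i))
       * (im_axis (1 * y') / (g j (im_axis (1 * y')) - complex_of_real (x $ j))) \<partial>\<mu>)
         \<longlongrightarrow> (\<integral>x. 1 / (g i (im_axis y) - complex_of_real (x $ i)) \<partial>\<mu>)) at_top"
      by (rule integral_resolvent_limit[OF asymptotic, where B = "1 / \<bar>Im (g i (im_axis y))\<bar>"])
        (use norm_cauchy_kernel_le[OF nonreal[OF y]] in auto)
    then have "((\<lambda>y'. \<integral>x. 1 / (g i (im_axis y) - complex_of_real (x $ i))
       * (im_axis y' / (g j (im_axis y') - complex_of_real (x $ j))) \<partial>\<mu>)
         \<longlongrightarrow> 1 / im_axis y) at_top"
      by (simp only: mult_1 cauchy_at_inverse[OF y])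
    then have "((\<lambda>y'. 1 - 1 / (im_axis y * (\<integral>x. 1 / (g i (im_axis y) - complex_of_real (x $ i))
       * (im_axis y' / (g j (im_axis y') - complex_of_real (x $ j))) \<partial>\<mu>)))
         \<longlongrightarrow> 1 - 1 / (im_axis y * (1 / im_axis y))) at_top"
      by (rule tendsto_diff[OF tendsto_const tendsto_divide[OF tendsto_const
            tendsto_mult[OF tendsto_const]]]) (use y0 in simp)
    then show ?thesis using y0 by simp
  qed
  have G2: "im_axis y' * cauchy_G2 \<mu> (g 1 (im_axis y)) (g 2 (im_axis y')) =
      (\<integral>x. 1 / (g 1 (im_axis y) - complex_of_real (x $ 1))
       * (im_axis y' / (g 2 (im_axis y') - complex_of_real (x $ 2))) \<partial>\<mu>)" for y y'
    unfolding cauchy_G2_def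
    by (subst integral_mult_right_zero[symmetric]) (simp add: field_simps)
  have G1: "im_axis y * cauchy_G2 \<mu> (g 1 (im_axis y)) (g 2 (im_axis y')) =
      (\<integral>x. 1 / (g 2 (im_axis y') - complex_of_real (x $ 2))
       * (im_axis y / (g 1 (im_axis y) - complex_of_real (x $ 1))) \<partial>\<mu>)" for y y'
    unfolding cauchy_G2_def
    by (subst integral_mult_right_zero[symmetric]) (simp add: field_simps)
  show "((\<lambda>y'. 1 - 1 / (im_axis y * im_axis y' * cauchy_G2 \<mu> (g 1 (im_axis y)) (g 2 (im_axis y'))))
      \<longlongrightarrow> 0) at_top"
    using *[of 1 2] by (simp only: G2[symmetric] mult.assoc)
  have "im_axis y' * im_axis y * G = im_axis y * (im_axis y' * G)" for y' G by simp
  then show "((\<lambda>y'. 1 - 1 / (im_axis y' * im_axis y * cauchy_G2 \<mu> (g 1 (im_axis y')) (g 2 (im_axis y))))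
      \<longlongrightarrow> 0) at_top"
    using *[of 2 1] by (simp only: G1[symmetric])
qed

lemma levy_khintchine_parts:
  assumes "R \<le> \<bar>y\<bar>" "R \<le> \<bar>y'\<bar>"
  shows "levy_exponent v A \<tau> 1 (im_axis y) + levy_exponent v A \<tau> 2 (im_axis y')
      + levy_coupling A \<tau> (im_axis y) (im_axis y') =
    (g 1 (im_axis y) - im_axis y) / im_axis y + (g 2 (im_axis y') - im_axis y') / im_axis y'
      + (1 - 1 / (im_axis y * im_axis y' * cauchy_G2 \<mu> (g 1 (im_axis y)) (g 2 (im_axis y'))))"
proof -
  have "1 \<le> \<bar>y\<bar>" "1 \<le> \<bar>y'\<bar>" using assms R by linarith+
  from levy_khintchine_split[OF this, of v A, symmetric] levy_khintchine[OF assms] show ?thesis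
    by (simp only: add_diff_eq)
qed

text \<open>
  The deviations \<open>d\<^sub>1(a)\<close> and \<open>d\<^sub>2(b)\<close> from the claim tend to 0 at infinity, and their sum \<open>H(a, b)\<close>
  tends to 0 as either variable does so with the other one fixed. Hence both are 0.
\<close>

lemma marginal_exponent:
  assumes y: "R \<le> \<bar>y\<bar>"
  shows "(g i (im_axis y) - im_axis y) / im_axis y = levy_exponent v A \<tau> i (im_axis y)"
proof -
  have y1: "1 \<le> \<bar>y\<bar>" using y R by linarith
  define d where "d j y = (g j (im_axis y) - im_axis y) / im_axis y - levy_exponent v A \<tau> j (im_axis y)" for j y
  have d0: "(d j \<longlongrightarrow> 0) at_top" for j
    using tendsto_diff[OF marginal_part_tendsto_0 levy_exponent_tendsto_0] by (simp add: d_def[abs_def])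
  define H where "H y y' = levy_coupling A \<tau> (im_axis y) (im_axis y')
      - (1 - 1 / (im_axis y * im_axis y' * cauchy_G2 \<mu> (g 1 (im_axis y)) (g 2 (im_axis y'))))" for y y'
  have H: "d 1 a + d 2 b = H a b" if "R \<le> \<bar>a\<bar>" "R \<le> \<bar>b\<bar>" for a b
    using levy_khintchine_parts[OF that] by (simp add: d_def H_def algebra_simps)
  have H0: "(H y \<longlongrightarrow> 0) at_top" "((\<lambda>y'. H y' y) \<longlongrightarrow> 0) at_top"
    unfolding H_def
    using tendsto_diff[OF levy_coupling_tendsto_0(1)[OF y1] joint_part_tendsto_0(1)[OF y]]
      tendsto_diff[OF levy_coupling_tendsto_0(2)[OF y1] joint_part_tendsto_0(2)[OF y]]
    by simp_all
  have ev: "eventually (\<lambda>y'. R \<le> \<bar>y'\<bar>) at_top"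
    using eventually_ge_at_top[of R] by eventually_elim simp
  have "((\<lambda>y'. H y y' - d 2 y') \<longlongrightarrow> 0) at_top" "((\<lambda>y'. H y' y - d 1 y') \<longlongrightarrow> 0) at_top"
    using tendsto_diff[OF H0(1) d0] tendsto_diff[OF H0(2) d0] by simp_all
  moreover have "eventually (\<lambda>y'. H y y' - d 2 y' = d 1 y) at_top"
      "eventually (\<lambda>y'. H y' y - d 1 y' = d 2 y) at_top"
    using ev by (eventually_elim, simp flip: H[OF y] H[OF _ y])+
  ultimately have "((\<lambda>y'::real. d 1 y) \<longlongrightarrow> 0) at_top" "((\<lambda>y'::real. d 2 y) \<longlongrightarrow> 0) at_top"
    using tendsto_cong by fast+
  then have "d 1 y = 0" "d 2 y = 0" by (simp_all add: tendsto_const_iff)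
  then show ?thesis using exhaust_2[of i] by (auto simp: d_def)
qed

lemma inverse_eq:
  assumes "R \<le> \<bar>y\<bar>"
  shows "g i (im_axis y) = im_axis y * (1 + levy_exponent v A \<tau> i (im_axis y))"
  using marginal_exponent[OF assms, of i] assms R by (auto simp: field_simps)

lemma joint_eq:
  assumes "R \<le> \<bar>y\<bar>" "R \<le> \<bar>y'\<bar>"
  shows "1 / (im_axis y * im_axis y' * cauchy_G2 \<mu> (g 1 (im_axis y)) (g 2 (im_axis y'))) =
    1 - levy_coupling A \<tau> (im_axis y) (im_axis y')"
  using levy_khintchine_parts[OF assms] marginal_exponent[OF assms(1)] marginal_exponent[OF assms(2)]
  by simp

text \<open>
  This comes from the explicit formula, whose coefficients are real. It turns the joint law at
  \<open>(iy, -iky)\<close> into an inner product.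
\<close>

lemma inverse_cnj:
  assumes "R \<le> \<bar>y\<bar>"
  shows "g i (im_axis (- y)) = cnj (g i (im_axis y))"
proof -
  have "im_axis (- y) = cnj (im_axis y)" by simp
  then have "levy_exponent v A \<tau> i (im_axis (- y)) = cnj (levy_exponent v A \<tau> i (im_axis y))"
    using levy_exponent_cnj by metis
  then show ?thesis using inverse_eq[of "- y" i] inverse_eq[of y i] assms by simp
qed

lemma Im_inverse:
  assumes "R \<le> \<bar>y\<bar>"
  shows "Im (g i (im_axis y)) = y * (1 - levy_variance A \<tau> i y)"
proof -
  have "1 \<le> \<bar>y\<bar>" using assms R by linarith
  from Re_levy_exponent[OF this, of v A i] inverse_eq[OF assms, of i] show ?thesis by simp
qed

lemma cauchy_kernel_mean_square:
  assumes "R \<le> \<bar>y\<bar>"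
  shows "(\<integral>x. (cmod (1 / (g i (im_axis y) - complex_of_real (x $ i))))\<^sup>2 \<partial>\<mu>)
    = 1 / (y * Im (g i (im_axis y)))"
proof -
  have "y \<noteq> 0" using assms R by auto
  moreover have [measurable]: "(\<lambda>x. x $ i) \<in> borel_measurable \<mu>" by measurable
  ultimately show ?thesis
    unfolding integral_norm_cauchy_kernel_sq[OF finite_measure_axioms nonreal[OF assms]
        \<open>(\<lambda>x. x $ i) \<in> borel_measurable \<mu>\<close>] cauchy_at_inverse[OF assms]
    by (simp add: Im_divide power2_eq_square)
qed

end

section \<open>Laws and Levy measures on a common line\<close>

context bifree_levy_law
begin

lemma levy_coupling_conjugate:
  assumes "y \<noteq> 0" "k \<noteq> 0"
  shows "levy_coupling A \<tau> (im_axis y) (im_axis (- (k * y))) =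
    complex_of_real (A $ 1 $ 2 / (k * y\<^sup>2))
      + (\<integral>x. (x $ 1 / (im_axis y - x $ 1)) * cnj (x $ 2 / (im_axis (k * y) - x $ 2)) \<partial>\<tau>)"
  using assms by (simp add: levy_coupling_def power2_eq_square mult_ac)

lemma cauchy_G2_conjugate:
  assumes "R \<le> \<bar>k * y\<bar>"
  shows "(\<integral>x. 1 / (g 1 (im_axis y) - x $ 1) * cnj (complex_of_real k / (g 2 (im_axis (k * y)) - x $ 2)) \<partial>\<mu>) =
    k * cauchy_G2 \<mu> (g 1 (im_axis y)) (g 2 (im_axis (- (k * y))))"
  unfolding cauchy_G2_def inverse_cnj[OF assms]
  by (subst integral_mult_right_zero[symmetric]) simp

text \<open>
  The joint formula at the pair \<open>(iy, -iky)\<close>, whose product is the positive or negative real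
  number \<open>k y\<^sup>2\<close>. The first factor on the left is \<open>y\<^sup>2\<close> times the inner product in
  \<open>L\<^sup>2(\<mu>)\<close> of \<open>cauchy_G2_conjugate\<close>, the second contains the inner product in \<open>L\<^sup>2(\<tau>)\<close> of
  \<open>levy_coupling_conjugate\<close>.
\<close>

lemma joint_conjugate:
  assumes y: "R \<le> \<bar>y\<bar>" "R \<le> \<bar>k * y\<bar>"
  shows "k * y\<^sup>2 * cauchy_G2 \<mu> (g 1 (im_axis y)) (g 2 (im_axis (- (k * y)))) *
    (1 - levy_coupling A \<tau> (im_axis y) (im_axis (- (k * y)))) = 1"
proof -
  have nz: "cauchy_G2 \<mu> (g 1 (im_axis y)) (g 2 (im_axis (- (k * y)))) \<noteq> 0"
    using levy_khintchine[of y "- (k * y)"] y by simp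
  moreover have "k * y \<noteq> 0" "y \<noteq> 0" using y R by auto
  moreover have "im_axis y * im_axis (- (k * y)) = complex_of_real (k * y\<^sup>2)"
    unfolding im_axis_mult by (simp add: power2_eq_square)
  ultimately show ?thesis
    using joint_eq[of y "- (k * y)"] y by (auto simp: field_simps)
qed

lemma exists_admissible:
  assumes "k \<noteq> 0" "eventually P at_top"
  obtains y where "P y" "R \<le> \<bar>y\<bar>" "R \<le> \<bar>k * y\<bar>" "y > 0"
proof -
  have "eventually (\<lambda>y. R \<le> y \<and> R / \<bar>k\<bar> \<le> y \<and> 0 < y) at_top"
    by (intro eventually_conj eventually_ge_at_top eventually_gt_at_top)
  with assms(2) have "eventually (\<lambda>y. P y \<and> R \<le> y \<and> R / \<bar>k\<bar> \<le> y \<and> 0 < y) at_top"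
    by eventually_elim simp
  then obtain y where "P y" "R \<le> y" "R / \<bar>k\<bar> \<le> y" "0 < y"
    using eventually_happens'[OF trivial_limit_at_top_linorder] by blast
  moreover from this have "R \<le> \<bar>k * y\<bar>" using assms(1) by (simp add: abs_mult field_simps)
  ultimately show ?thesis using that by simp
qed

lemma Im_inverse_nonzero: "R \<le> \<bar>y\<bar> \<Longrightarrow> Im (g i (im_axis y)) \<noteq> 0"
  using nonreal complex_is_Real_iff by blast

text \<open>
  On the line, the functions \<open>s/(iy - s)\<close> and \<open>t/(iky - t)\<close> coincide, so the coupling is the
  variance \<open>Q\<^sub>1(y)\<close>. The joint formula then makes the inner product of
  \<open>1/(g\<^sub>1(iy) - X)\<close> and \<open>k/(g\<^sub>2(iky) - Y)\<close> equal to \<open>1/(y Im (g\<^sub>1(iy)))\<close>, which is also the square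
  of each norm. So the two functions agree, and solving for \<open>Y\<close> gives the line.
\<close>

lemma law_on_line_if_levy_on_line:
  assumes k: "k \<noteq> 0" and A12: "A $ 1 $ 2 = k * A $ 1 $ 1" and A22: "A $ 2 $ 2 = k\<^sup>2 * A $ 1 $ 1"
    and line: "AE x in \<tau>. x $ 2 = k * x $ 1"
  shows "AE x in \<mu>. x $ 2 = k * x $ 1 + (v $ 2 - k * v $ 1)"
proof -
  obtain y where y: "R \<le> \<bar>y\<bar>" "R \<le> \<bar>k * y\<bar>" "y > 0"
    using exists_admissible[OF k, of "\<lambda>_. True"] by auto
  define d where "d = v $ 2 - k * v $ 1"
  let ?z = "g 1 (im_axis y)" and ?w = "g 2 (im_axis (k * y))"
  have scale: "im_axis (k * y) = of_real k * im_axis y" by simp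
  have kern: "(\<integral>x. levy_kernel (x $ 2) ((norm x)\<^sup>2) (im_axis (k * y)) \<partial>\<tau>) =
      (\<integral>x. levy_kernel (x $ 1) ((norm x)\<^sup>2) (im_axis y) \<partial>\<tau>)"
  proof (rule integral_cong_AE)
    show "AE x in \<tau>. levy_kernel (x $ 2) ((norm x)\<^sup>2) (im_axis (k * y)) =
        levy_kernel (x $ 1) ((norm x)\<^sup>2) (im_axis y)"
      using line by eventually_elim (simp only: scale levy_kernel_scale[OF k])
  qed (unfold levy_kernel_def, measurable)
  have "levy_exponent v A \<tau> 2 (im_axis (k * y)) =
      levy_exponent v A \<tau> 1 (im_axis y) + complex_of_real (d / k) / im_axis y"
    unfolding levy_exponent_def kern A22 d_def
    using k y(3) by (simp add: field_simps power2_eq_square)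
  then have w: "?w = of_real k * ?z + of_real d"
    using k y(3) unfolding inverse_eq[OF y(1)] inverse_eq[OF y(2)]
    by (simp add: field_simps)
  define f where "f x = 1 / (?z - complex_of_real (x $ 1))" for x :: "real^2"
  define h where "h x = complex_of_real k / (?w - complex_of_real (x $ 2))" for x :: "real^2"
  have m1 [measurable]: "(\<lambda>x. x $ 1) \<in> borel_measurable \<mu>" by measurable
  have m2 [measurable]: "(\<lambda>x. x $ 2) \<in> borel_measurable \<mu>" by measurable
  have [measurable]: "f \<in> borel_measurable \<mu>" "h \<in> borel_measurable \<mu>"
    unfolding f_def h_def by measurable
  have h2: "(cmod (h x))\<^sup>2 = k\<^sup>2 * (cmod (1 / (?w - complex_of_real (x $ 2))))\<^sup>2" for x
    by (simp add: h_def norm_divide power_divide)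
  have Imw: "Im ?w = k * Im ?z" using w by simp
  have f_int: "(\<integral>x. (cmod (f x))\<^sup>2 \<partial>\<mu>) = 1 / (y * Im ?z)"
    unfolding f_def by (rule cauchy_kernel_mean_square[OF y(1)])
  have h_int: "(\<integral>x. (cmod (h x))\<^sup>2 \<partial>\<mu>) = 1 / (y * Im ?z)"
    unfolding h2 using cauchy_kernel_mean_square[OF y(2), of 2] k Imw
    by (simp add: power2_eq_square)
  have coupling: "levy_coupling A \<tau> (im_axis y) (im_axis (- (k * y))) = of_real (levy_variance A \<tau> 1 y)"
  proof -
    have "(\<integral>x. (x $ 1 / (im_axis y - x $ 1)) * cnj (x $ 2 / (im_axis (k * y) - x $ 2)) \<partial>\<tau>) =
        (\<integral>x. complex_of_real ((x $ 1)\<^sup>2 / (y\<^sup>2 + (x $ 1)\<^sup>2)) \<partial>\<tau>)"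
    proof (rule integral_cong_AE)
      show "AE x in \<tau>. (x $ 1 / (im_axis y - x $ 1)) * cnj (x $ 2 / (im_axis (k * y) - x $ 2)) =
          complex_of_real ((x $ 1)\<^sup>2 / (y\<^sup>2 + (x $ 1)\<^sup>2))"
        using line
      proof eventually_elim
        case (elim x)
        have "x $ 2 / (im_axis (k * y) - x $ 2) = complex_of_real k * (x $ 1) / (of_real k * (im_axis y - x $ 1))"
          unfolding elim scale by (simp add: algebra_simps)
        also have "\<dots> = x $ 1 / (im_axis y - x $ 1)" using k by simp
        finally have "(x $ 1 / (im_axis y - x $ 1)) * cnj (x $ 2 / (im_axis (k * y) - x $ 2)) =
          of_real ((cmod (x $ 1 / (im_axis y - x $ 1)))\<^sup>2)"
          by (simp only: complex_norm_square)
        then show ?case by (simp only: norm_resolvent_sq)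
      qed
      have [measurable]: "cnj \<in> borel_measurable borel"
        by (intro borel_measurable_continuous_onI continuous_intros)
      show "(\<lambda>x. (x $ 1 / (im_axis y - x $ 1)) * cnj (x $ 2 / (im_axis (k * y) - x $ 2))) \<in> borel_measurable \<tau>"
        by measurable
    qed measurable
    also have "\<dots> = of_real (\<integral>x. (x $ 1)\<^sup>2 / (y\<^sup>2 + (x $ 1)\<^sup>2) \<partial>\<tau>)"
      by (rule integral_complex_of_real)
    finally have int: "(\<integral>x. (x $ 1 / (im_axis y - x $ 1)) * cnj (x $ 2 / (im_axis (k * y) - x $ 2)) \<partial>\<tau>) = \<dots>" .
    have "A $ 1 $ 2 / (k * y\<^sup>2) = A $ 1 $ 1 / y\<^sup>2" using k A12 by simp
    then show ?thesis
      unfolding levy_coupling_conjugate[OF less_imp_neq[OF y(3), symmetric] k] int levy_variance_def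
      by (simp only: of_real_add)
  qed
  from joint_conjugate[OF y(1,2)] have
    "k * cauchy_G2 \<mu> ?z (g 2 (im_axis (- (k * y)))) * of_real (y * Im ?z) = 1"
    unfolding coupling Im_inverse[OF y(1)] by (simp add: power2_eq_square mult_ac)
  then have fh: "(\<integral>x. f x * cnj (h x) \<partial>\<mu>) = of_real (1 / (y * Im ?z))"
    unfolding f_def h_def cauchy_G2_conjugate[OF y(2)]
    using Im_inverse_nonzero[OF y(1), of 1] y(3) by (simp add: field_simps)
  have "AE x in \<mu>. f x = h x"
  proof (rule AE_eq_if_mean_square_distance_nonpos)
    show "integrable \<mu> (\<lambda>x. (cmod (f x))\<^sup>2)" unfolding f_def
      by (rule integrable_cauchy_kernel(2)[OF finite_measure_axioms nonreal[OF y(1)] m1])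
    show "integrable \<mu> (\<lambda>x. (cmod (h x))\<^sup>2)" unfolding h2
      by (intro integrable_mult_right
          integrable_cauchy_kernel(2)[OF finite_measure_axioms nonreal[OF y(2)] m2])
    show "(\<integral>x. (cmod (f x))\<^sup>2 \<partial>\<mu>) + (\<integral>x. (cmod (h x))\<^sup>2 \<partial>\<mu>) - 2 * Re (\<integral>x. f x * cnj (h x) \<partial>\<mu>) \<le> 0"
      unfolding f_int h_int fh Re_complex_of_real by simp
  qed measurable
  then show ?thesis
  proof eventually_elim
    case (elim x)
    have "?z - x $ 1 \<noteq> 0" "?w - x $ 2 \<noteq> 0"
      using nonreal[OF y(1)] nonreal[OF y(2)] by (metis Reals_of_real eq_iff_diff_eq_0)+
    with elim have "?w - x $ 2 = k * (?z - x $ 1)" by (simp add: f_def h_def field_simps)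
    then have "complex_of_real (x $ 2) = complex_of_real (k * x $ 1 + d)"
      unfolding w by (simp add: algebra_simps)
    then show ?case unfolding of_real_eq_iff d_def .
  qed
qed

text \<open>
  The mirror image of the previous argument: now the two Cauchy kernels coincide, which forces the
  coupling to be \<open>Q = Q\<^sub>1(y) = Q\<^sub>2(k y)\<close>. Splitting off the contributions of \<open>A\<close> from these three
  expressions for \<open>Q\<close> leaves the two norms and the inner product in \<open>L\<^sup>2(\<tau>)\<close>, and the \<open>Q\<close> cancel.
\<close>

lemma levy_on_line_if_law_on_line:
  assumes k: "k \<noteq> 0" and line: "AE x in \<mu>. x $ 2 = k * x $ 1 + d"
  shows "A $ 1 $ 1 - 2 * A $ 1 $ 2 / k + A $ 2 $ 2 / k\<^sup>2 = 0" and "AE x in \<tau>. x $ 2 = k * x $ 1"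
proof -
  have [measurable]: "cnj \<in> borel_measurable borel"
    by (intro borel_measurable_continuous_onI continuous_intros)
  have "eventually (\<lambda>y. g 2 (im_axis (k * y)) = of_real k * g 1 (im_axis y) + of_real d) at_top"
  proof (rule asymptotic_inverse_unique[OF asymptotic[OF k] _ k])
    show "(\<lambda>x. x $ 2) \<in> borel_measurable \<mu>" by measurable
    have ev: "eventually (\<lambda>y. R \<le> \<bar>y\<bar> \<and> R \<le> \<bar>k * y\<bar> \<and> 0 < y) at_top"
      using eventually_ge_at_top[of R] eventually_ge_at_top[of "R / \<bar>k\<bar>"] eventually_gt_at_top[of 0]
      by eventually_elim (use k in \<open>simp add: abs_mult field_simps\<close>)
    have "((\<lambda>y. g 1 (im_axis (1 * y)) / im_axis (1 * y) + (d / k) / im_axis y) \<longlongrightarrow> 1 + 0) at_top"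
      by (intro tendsto_add asymptotic inverse_im_axis_tendsto_0) simp
    moreover have "eventually (\<lambda>y. g 1 (im_axis (1 * y)) / im_axis (1 * y) + (d / k) / im_axis y =
        (of_real k * g 1 (im_axis y) + of_real d) / im_axis (k * y)) at_top"
      using eventually_gt_at_top[of 0] by eventually_elim (use k in \<open>simp add: field_simps\<close>)
    ultimately show "((\<lambda>y. (of_real k * g 1 (im_axis y) + of_real d) / im_axis (k * y)) \<longlongrightarrow> 1) at_top"
      by (simp add: tendsto_cong)
    show "eventually (\<lambda>y. g 2 (im_axis (k * y)) \<notin> \<real> \<and> of_real k * g 1 (im_axis y) + of_real d \<notin> \<real>) at_top"
      using ev
    proof eventually_elim
      case (elim y)
      have "of_real k * g 1 (im_axis y) + of_real d \<notin> \<real>"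
        using k Im_inverse_nonzero[OF conjunct1[OF elim], of 1] by (simp add: complex_is_Real_iff)
      then show ?case using nonreal[of "k * y" 2] elim by blast
    qed
    show "eventually (\<lambda>y. (\<integral>x. 1 / (g 2 (im_axis (k * y)) - complex_of_real (x $ 2)) \<partial>\<mu>) =
        (\<integral>x. 1 / ((of_real k * g 1 (im_axis y) + of_real d) - complex_of_real (x $ 2)) \<partial>\<mu>)) at_top"
      using ev
    proof eventually_elim
      case (elim y)
      have "(\<integral>x. 1 / ((of_real k * g 1 (im_axis y) + of_real d) - complex_of_real (x $ 2)) \<partial>\<mu>) =
          (\<integral>x. (1 / of_real k) * (1 / (g 1 (im_axis y) - complex_of_real (x $ 1))) \<partial>\<mu>)"
      proof (rule integral_cong_AE)
        show "AE x in \<mu>. 1 / ((of_real k * g 1 (im_axis y) + of_real d) - complex_of_real (x $ 2)) =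
            (1 / of_real k) * (1 / (g 1 (im_axis y) - complex_of_real (x $ 1)))"
          using line
        proof eventually_elim
          case (elim x)
          have "of_real k * g 1 (im_axis y) + of_real d - complex_of_real (x $ 2) =
              of_real k * (g 1 (im_axis y) - complex_of_real (x $ 1))"
            unfolding elim by (simp add: algebra_simps)
          then show ?case by simp
        qed
      qed measurable
      also have "\<dots> = (1 / of_real k) * (1 / im_axis y)"
        using cauchy_at_inverse[OF conjunct1[OF elim], of 1] by (subst integral_mult_right_zero) simp
      finally show ?case using elim cauchy_at_inverse[of "k * y" 2] by simp
    qed
  qed
  then obtain y where y: "R \<le> \<bar>y\<bar>" "R \<le> \<bar>k * y\<bar>" "y > 0"
    and w: "g 2 (im_axis (k * y)) = of_real k * g 1 (im_axis y) + of_real d"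
    using exists_admissible[OF k] by blast
  let ?z = "g 1 (im_axis y)" and ?w = "g 2 (im_axis (k * y))"
  define Q where "Q = levy_variance A \<tau> 1 y"
  have "Im ?w = k * Im ?z" using w by simp
  then have Q2: "levy_variance A \<tau> 2 (k * y) = Q"
    unfolding Im_inverse[OF y(1)] Im_inverse[OF y(2)] Q_def using k y(3) by simp
  have "k * cauchy_G2 \<mu> ?z (g 2 (im_axis (- (k * y)))) = of_real (1 / (y * Im ?z))"
  proof -
    have "(\<integral>x. 1 / (?z - x $ 1) * cnj (complex_of_real k / (?w - x $ 2)) \<partial>\<mu>) =
        (\<integral>x. complex_of_real ((cmod (1 / (?z - complex_of_real (x $ 1))))\<^sup>2) \<partial>\<mu>)"
    proof (rule integral_cong_AE)
      show "AE x in \<mu>. 1 / (?z - x $ 1) * cnj (complex_of_real k / (?w - x $ 2)) =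
          complex_of_real ((cmod (1 / (?z - complex_of_real (x $ 1))))\<^sup>2)"
        using line
      proof eventually_elim
        case (elim x)
        have "?w - x $ 2 = of_real k * (?z - x $ 1)"
          unfolding elim w by (simp add: algebra_simps)
        then have "complex_of_real k / (?w - x $ 2) = 1 / (?z - x $ 1)" using k by simp
        then show ?case by (simp only: complex_norm_square)
      qed
    qed measurable
    also have "\<dots> = of_real (1 / (y * Im ?z))"
      using cauchy_kernel_mean_square[OF y(1), of 1] by (simp only: integral_complex_of_real)
    finally show ?thesis unfolding cauchy_G2_conjugate[OF y(2)] .
  qed
  moreover have "complex_of_real k * y\<^sup>2 * G = (of_real k * G) * y\<^sup>2" for G by simp
  ultimately have "of_real (1 / (y * Im ?z)) * of_real (y\<^sup>2) *
      (1 - levy_coupling A \<tau> (im_axis y) (im_axis (- (k * y)))) = 1"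
    using joint_conjugate[OF y(1,2)] by (simp only: of_real_mult of_real_power)
  then have "of_real y * (1 - levy_coupling A \<tau> (im_axis y) (im_axis (- (k * y)))) = complex_of_real (Im ?z)"
    using Im_inverse_nonzero[OF y(1), of 1] y(3) by (simp add: field_simps power2_eq_square)
  then have "of_real y * (1 - levy_coupling A \<tau> (im_axis y) (im_axis (- (k * y)))) = of_real y * (1 - of_real Q)"
    unfolding Im_inverse[OF y(1)] Q_def by simp
  then have coupling: "levy_coupling A \<tau> (im_axis y) (im_axis (- (k * y))) = of_real Q"
    using y(3) by simp
  define f where "f x = complex_of_real (x $ 1) / (im_axis y - complex_of_real (x $ 1))" for x :: "real^2"
  define h where "h x = complex_of_real (x $ 2) / (im_axis (k * y) - complex_of_real (x $ 2))" for x :: "real^2"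
  have [measurable]: "f \<in> borel_measurable \<tau>" "h \<in> borel_measurable \<tau>"
    unfolding f_def h_def by measurable
  have f_int: "(\<integral>x. (cmod (f x))\<^sup>2 \<partial>\<tau>) = Q - A $ 1 $ 1 / y\<^sup>2"
    unfolding f_def norm_resolvent_sq Q_def levy_variance_def by simp
  have h_int: "(\<integral>x. (cmod (h x))\<^sup>2 \<partial>\<tau>) = Q - A $ 2 $ 2 / (k * y)\<^sup>2"
    unfolding h_def norm_resolvent_sq Q2[symmetric] levy_variance_def by simp
  have fh: "Re (\<integral>x. f x * cnj (h x) \<partial>\<tau>) = Q - A $ 1 $ 2 / (k * y\<^sup>2)"
    using arg_cong[OF coupling, of Re]
    unfolding levy_coupling_conjugate[OF less_imp_neq[OF y(3), symmetric] k]
      f_def[symmetric] h_def[symmetric] plus_complex.sel Re_complex_of_real by linarith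
  have y1: "1 \<le> \<bar>y\<bar>" "1 \<le> \<bar>k * y\<bar>" using y R by linarith+
  have f2: "integrable \<tau> (\<lambda>x. (cmod (f x))\<^sup>2)" and h2: "integrable \<tau> (\<lambda>x. (cmod (h x))\<^sup>2)"
    unfolding f_def h_def by (intro integrable_norm_resolvent_sq y1)+
  define q where "q = A $ 1 $ 1 - 2 * A $ 1 $ 2 / k + A $ 2 $ 2 / k\<^sup>2"
  have dist: "(\<integral>x. (cmod (f x))\<^sup>2 \<partial>\<tau>) + (\<integral>x. (cmod (h x))\<^sup>2 \<partial>\<tau>) - 2 * Re (\<integral>x. f x * cnj (h x) \<partial>\<tau>) = - q / y\<^sup>2"
    unfolding f_int h_int fh q_def using k y(3) by (simp add: field_simps)
  have q0: "q \<ge> 0"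
  proof -
    \<comment> \<open>a normal vector of the line \<open>t = k s\<close>\<close>
    define u :: "real^2" where "u = vector [1, - 1 / k]"
    have "u \<bullet> (A *v u) = q"
      unfolding inner_vec2 matrix_vector_mult_2 pos_semidef_symmetric[OF pos_semidef, of 2 1]
      using k by (simp add: u_def q_def power2_eq_square field_simps)
    moreover have "0 \<le> u \<bullet> (A *v u)" using pos_semidef by (simp add: pos_semidef_def)
    ultimately show ?thesis by simp
  qed
  have "0 \<le> (\<integral>x. (cmod (f x - h x))\<^sup>2 \<partial>\<tau>)" by simp
  then have "0 \<le> - q / y\<^sup>2" using mean_square_distance(3)[OF _ _ f2 h2] dist by simp
  then have "q = 0" using q0 y(3) by (simp add: divide_le_0_iff)
  then show "A $ 1 $ 1 - 2 * A $ 1 $ 2 / k + A $ 2 $ 2 / k\<^sup>2 = 0" by (simp add: q_def)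
  have "AE x in \<tau>. f x = h x"
    by (rule AE_eq_if_mean_square_distance_nonpos[OF _ _ f2 h2]) (use dist \<open>q = 0\<close> in simp_all)
  then show "AE x in \<tau>. x $ 2 = k * x $ 1"
  proof eventually_elim
    case (elim x)
    have "im_axis y - x $ 1 \<noteq> 0" "im_axis (k * y) - x $ 2 \<noteq> 0"
      using im_axis_minus_nonzero k y(3) by (metis less_irrefl mult_eq_0_iff)+
    with elim have "x $ 1 * (im_axis (k * y) - x $ 2) = x $ 2 * (im_axis y - x $ 1)"
      by (simp add: f_def h_def field_simps)
    \<comment> \<open>The products \<open>s t\<close> on both sides are real, so imaginary parts compare \<open>k y s\<close> with \<open>y t\<close>.\<close>
    from arg_cong[OF this, of Im] show ?case using y(3) by (simp add: mult.commute)
  qed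
qed

text \<open>
  Here \<open>g\<^sub>i(iy) = iy + v\<^sub>i\<close>, and \<open>1/(g\<^sub>i(iy) - X\<^sub>i)\<close> is compared with the constant \<open>1/(iy)\<close>, its mean.
  Its mean square is \<open>1/y\<^sup>2\<close>, so its variance is 0. Any \<open>y \<ge> R\<close> would do; \<open>y = R\<close> is chosen.
\<close>

lemma law_on_axis_line_if_levy:
  assumes Aii: "A $ i $ i = 0" and line: "AE x in \<tau>. x $ i = 0"
  shows "AE x in \<mu>. x $ i = v $ i"
proof -
  have R0: "R \<le> \<bar>R\<bar>" "R > 0" using R by auto
  have m [measurable]: "(\<lambda>x. x $ i) \<in> borel_measurable \<mu>" by measurable
  have "(\<integral>x. levy_kernel (x $ i) ((norm x)\<^sup>2) (im_axis R) \<partial>\<tau>) = (\<integral>x. 0 \<partial>\<tau>)"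
    by (rule integral_cong_AE)
      (use line in \<open>auto simp: levy_kernel_def elim: eventually_mono\<close>)
  then have z: "g i (im_axis R) = im_axis R + v $ i"
    using R0(2) unfolding inverse_eq[OF R0(1)] levy_exponent_def Aii by (simp add: field_simps)
  define f where "f x = 1 / (g i (im_axis R) - complex_of_real (x $ i))" for x :: "real^2"
  have [measurable]: "f \<in> borel_measurable \<mu>" unfolding f_def by measurable
  have f2: "integrable \<mu> (\<lambda>x. (cmod (f x))\<^sup>2)" unfolding f_def
    by (rule integrable_cauchy_kernel(2)[OF finite_measure_axioms nonreal[OF R0(1)] m])
  have "(\<integral>x. f x * cnj (1 / im_axis R) \<partial>\<mu>) = 1 / im_axis R * cnj (1 / im_axis R)"
    using cauchy_at_inverse[OF R0(1), of i] unfolding f_def by (subst integral_mult_left_zero) simp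
  then have fh: "Re (\<integral>x. f x * cnj (1 / im_axis R) \<partial>\<mu>) = 1 / R\<^sup>2"
    unfolding complex_norm_square[symmetric] by (simp add: norm_divide norm_mult power_divide)
  have "AE x in \<mu>. f x = 1 / im_axis R"
  proof (rule AE_eq_if_mean_square_distance_nonpos[OF _ _ f2])
    have "(\<integral>x. (cmod (f x))\<^sup>2 \<partial>\<mu>) = 1 / R\<^sup>2"
      using cauchy_kernel_mean_square[OF R0(1), of i] z unfolding f_def by (simp add: power2_eq_square)
    then show "(\<integral>x. (cmod (f x))\<^sup>2 \<partial>\<mu>) + (\<integral>x. (cmod (1 / im_axis R))\<^sup>2 \<partial>\<mu>)
        - 2 * Re (\<integral>x. f x * cnj (1 / im_axis R) \<partial>\<mu>) \<le> 0"
      unfolding fh using R0(2) by (simp add: norm_divide norm_mult power_divide prob_space)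
  qed auto
  then show ?thesis
  proof eventually_elim
    case (elim x)
    then have "inverse (g i (im_axis R) - complex_of_real (x $ i)) = inverse (im_axis R)"
      by (simp only: f_def divide_inverse mult_1)
    then show ?case unfolding z inverse_eq_iff_eq by simp
  qed
qed

text \<open>
  For a point mass at \<open>d\<close> the equation for \<open>g\<^sub>i\<close> can be solved exactly: \<open>g\<^sub>i(iy) = iy + d\<close>. So
  \<open>Im (g\<^sub>i(iy)) = y\<close> and \<open>Q\<^sub>i(y) = 0\<close>, a sum of two non-negative terms.
\<close>

lemma levy_on_axis_line_if_law:
  assumes line: "AE x in \<mu>. x $ i = d"
  shows "A $ i $ i = 0" and "AE x in \<tau>. x $ i = 0"
proof -
  have R0: "R \<le> \<bar>R\<bar>" "R > 0" using R by auto
  have "(\<integral>x. 1 / (g i (im_axis R) - complex_of_real (x $ i)) \<partial>\<mu>) =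
      (\<integral>x. 1 / (g i (im_axis R) - complex_of_real d) \<partial>\<mu>)"
    by (rule integral_cong_AE) (use line in \<open>auto elim: eventually_mono\<close>)
  then have "1 / im_axis R = 1 / (g i (im_axis R) - complex_of_real d)"
    using cauchy_at_inverse[OF R0(1), of i] by (simp add: prob_space)
  then have "im_axis R = g i (im_axis R) - complex_of_real d"
    by (simp only: divide_inverse mult_1 inverse_eq_iff_eq)
  then have "g i (im_axis R) = im_axis R + complex_of_real d"
    by (simp only: eq_diff_eq)
  then have "levy_variance A \<tau> i R = 0"
    using Im_inverse[OF R0(1), of i] R0(2) by simp
  moreover have int: "integrable \<tau> (\<lambda>x. (x $ i)\<^sup>2 / (R\<^sup>2 + (x $ i)\<^sup>2))"
    using integrable_norm_resolvent_sq[of R i] R unfolding norm_resolvent_sq by simp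
  moreover have "0 \<le> (\<integral>x. (x $ i)\<^sup>2 / (R\<^sup>2 + (x $ i)\<^sup>2) \<partial>\<tau>)" by simp
  moreover have "0 \<le> A $ i $ i"
  proof -
    have "axis i 1 \<bullet> (A *v axis i 1) = A $ i $ i"
      by (simp add: inner_axis' matrix_vector_mult_basis column_def)
    moreover have "0 \<le> axis i 1 \<bullet> (A *v axis i 1)" using pos_semidef by (simp add: pos_semidef_def)
    ultimately show ?thesis by simp
  qed
  ultimately have *: "A $ i $ i / R\<^sup>2 = 0" "(\<integral>x. (x $ i)\<^sup>2 / (R\<^sup>2 + (x $ i)\<^sup>2) \<partial>\<tau>) = 0"
    unfolding levy_variance_def
    by (smt (verit) divide_nonneg_nonneg zero_le_power2)+
  then show "A $ i $ i = 0" using R0(2) by simp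
  have "AE x in \<tau>. (x $ i)\<^sup>2 / (R\<^sup>2 + (x $ i)\<^sup>2) = 0"
    using *(2) integral_nonneg_eq_0_iff_AE[OF int] by simp
  then show "AE x in \<tau>. x $ i = 0"
    by eventually_elim (use R0(2) in \<open>simp add: add_nonneg_eq_0_iff\<close>)
qed

end

context bifree_levy_law
begin

lemma AE_law_line_if_levy:
  assumes u: "u \<noteq> 0" and Au: "A *v u = 0" and line: "AE x in \<tau>. u \<bullet> x = 0"
  shows "AE x in \<mu>. u \<bullet> x = u \<bullet> v"
proof -
  have A: "A $ 1 $ 1 * u $ 1 + A $ 1 $ 2 * u $ 2 = 0" "A $ 1 $ 2 * u $ 1 + A $ 2 $ 2 * u $ 2 = 0"
    using matrix_vector_mult_2[of A u 1] matrix_vector_mult_2[of A u 2]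
      pos_semidef_symmetric[OF pos_semidef, of 1 2] by (simp_all add: Au)
  consider "u $ 1 = 0" "u $ 2 \<noteq> 0" | "u $ 1 \<noteq> 0" "u $ 2 = 0" | "u $ 1 \<noteq> 0" "u $ 2 \<noteq> 0"
    using u by (auto simp: vec_eq_iff forall_2)
  then show ?thesis
  proof cases
    case 1
    then have "A $ 2 $ 2 = 0" "AE x in \<tau>. x $ 2 = 0" using A line by (simp_all add: inner_vec2)
    from law_on_axis_line_if_levy[OF this] show ?thesis
      by eventually_elim (simp add: inner_vec2 1)
  next
    case 2
    then have "A $ 1 $ 1 = 0" "AE x in \<tau>. x $ 1 = 0" using A line by (simp_all add: inner_vec2)
    from law_on_axis_line_if_levy[OF this] show ?thesis
      by eventually_elim (simp add: inner_vec2 2)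
  next
    case 3
    define k where "k = - u $ 1 / u $ 2"
    have k: "k \<noteq> 0" "u $ 1 = - k * u $ 2" using 3 by (simp_all add: k_def)
    have "(A $ 1 $ 2 - k * A $ 1 $ 1) * u $ 2 = 0" "(A $ 2 $ 2 - k * A $ 1 $ 2) * u $ 2 = 0"
      using A unfolding k(2) by (simp_all add: algebra_simps)
    then have A12: "A $ 1 $ 2 = k * A $ 1 $ 1" and A22: "A $ 2 $ 2 = k\<^sup>2 * A $ 1 $ 1"
      using 3 by (simp_all add: power2_eq_square)
    have eq: "u \<bullet> x = c \<longleftrightarrow> x $ 2 = k * x $ 1 + c / u $ 2" for x :: "real^2" and c
      using 3 unfolding inner_vec2 k(2) by (auto simp: field_simps)
    have "AE x in \<tau>. x $ 2 = k * x $ 1" using line unfolding eq by simp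
    note law = law_on_line_if_levy_on_line[OF k(1) A12 A22 this]
    have "u \<bullet> v / u $ 2 = v $ 2 - k * v $ 1"
      unfolding inner_vec2 k(2) using 3 by (simp add: field_simps)
    with law show ?thesis unfolding eq by simp
  qed
qed

lemma AE_levy_line_if_law:
  assumes u: "u \<noteq> 0" and line: "AE x in \<mu>. u \<bullet> x = c"
  shows "A *v u = 0" and "AE x in \<tau>. u \<bullet> x = 0"
proof -
  have quad: "u \<bullet> (A *v u) = (u $ 1)\<^sup>2 * A $ 1 $ 1 + 2 * u $ 1 * u $ 2 * A $ 1 $ 2 + (u $ 2)\<^sup>2 * A $ 2 $ 2"
    unfolding inner_vec2 matrix_vector_mult_2 pos_semidef_symmetric[OF pos_semidef, of 2 1]
    by (simp add: algebra_simps power2_eq_square)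
  consider "u $ 1 = 0" "u $ 2 \<noteq> 0" | "u $ 1 \<noteq> 0" "u $ 2 = 0" | "u $ 1 \<noteq> 0" "u $ 2 \<noteq> 0"
    using u by (auto simp: vec_eq_iff forall_2)
  then have "u \<bullet> (A *v u) = 0 \<and> (AE x in \<tau>. u \<bullet> x = 0)"
  proof cases
    case 1
    have "AE x in \<mu>. x $ 2 = c / u $ 2"
      using line by eventually_elim (use 1 in \<open>simp add: inner_vec2 field_simps\<close>)
    from levy_on_axis_line_if_law[OF this] show ?thesis
      using 1 unfolding quad by (simp add: inner_vec2)
  next
    case 2
    have "AE x in \<mu>. x $ 1 = c / u $ 1"
      using line by eventually_elim (use 2 in \<open>simp add: inner_vec2 field_simps\<close>)
    from levy_on_axis_line_if_law[OF this] show ?thesis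
      using 2 unfolding quad by (simp add: inner_vec2)
  next
    case 3
    define k where "k = - u $ 1 / u $ 2"
    have k: "k \<noteq> 0" "u $ 1 = - k * u $ 2" using 3 by (simp_all add: k_def)
    have eq: "u \<bullet> x = c \<longleftrightarrow> x $ 2 = k * x $ 1 + c / u $ 2" for x :: "real^2" and c
      using 3 unfolding inner_vec2 k(2) by (auto simp: field_simps)
    have "AE x in \<mu>. x $ 2 = k * x $ 1 + c / u $ 2" using line unfolding eq .
    note * = levy_on_line_if_law_on_line[OF k(1) this]
    have "u \<bullet> (A *v u) = (k * u $ 2)\<^sup>2 * (A $ 1 $ 1 - 2 * A $ 1 $ 2 / k + A $ 2 $ 2 / k\<^sup>2)"
      unfolding quad k(2) using k(1) by (simp add: field_simps power2_eq_square)
    then show ?thesis using * unfolding eq by simp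
  qed
  then show "A *v u = 0" "AE x in \<tau>. u \<bullet> x = 0"
    using pos_semidef_quadratic_zero[OF pos_semidef] by auto
qed

end

section \<open>From the characteristic triplet to the imaginary axis\<close>

lemma im_axis_in_truncated_cone:
  assumes "0 < \<theta>" "M \<le> \<bar>y\<bar>"
  shows "im_axis y \<in> truncated_cone \<theta> M"
  using assms by (simp add: truncated_cone_def)

lemma is_F_inverse_im_axis:
  assumes inv: "is_F_inverse (marginal i \<mu>) (truncated_cone \<theta> M) g" and \<theta>: "0 < \<theta>"
    and sets: "sets \<mu> = sets borel"
  shows "M \<le> \<bar>y\<bar> \<Longrightarrow> g (im_axis y) \<notin> \<real>"
    and "M \<le> \<bar>y\<bar> \<Longrightarrow> y \<noteq> 0 \<Longrightarrow>
      (\<integral>x. 1 / (g (im_axis y) - complex_of_real (x $ i)) \<partial>\<mu>) = 1 / im_axis y"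
    and "c \<noteq> 0 \<Longrightarrow> ((\<lambda>y. g (im_axis (c * y)) / im_axis (c * y)) \<longlongrightarrow> 1) at_top"
proof -
  note in_cone = im_axis_in_truncated_cone[OF \<theta>]
  show "g (im_axis y) \<notin> \<real>" if "M \<le> \<bar>y\<bar>"
    using inv in_cone[OF that] by (auto simp: is_F_inverse_def)
  show "(\<integral>x. 1 / (g (im_axis y) - complex_of_real (x $ i)) \<partial>\<mu>) = 1 / im_axis y"
    if "M \<le> \<bar>y\<bar>" "y \<noteq> 0"
  proof -
    have [measurable_cong]: "sets \<mu> = sets borel" by (fact sets)
    have "cauchy_F (marginal i \<mu>) (g (im_axis y)) = im_axis y"
      using inv in_cone[OF that(1)] by (auto simp: is_F_inverse_def)
    then have "cauchy_G (marginal i \<mu>) (g (im_axis y)) = 1 / im_axis y"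
      unfolding cauchy_F_def
      by (metis div_by_1 divide_divide_eq_right mult_1)
    moreover have "cauchy_G (marginal i \<mu>) z = (\<integral>x. 1 / (z - complex_of_real (x $ i)) \<partial>\<mu>)" for z
      unfolding cauchy_G_def marginal_def by (rule integral_distr) measurable
    ultimately show ?thesis by simp
  qed
  show "((\<lambda>y. g (im_axis (c * y)) / im_axis (c * y)) \<longlongrightarrow> 1) at_top" if c: "c \<noteq> 0"
  proof (rule filterlim_compose[where f = "\<lambda>y. im_axis (c * y)" and g = "\<lambda>z. g z / z"])
    show "((\<lambda>z. g z / z) \<longlongrightarrow> 1) (inf at_infinity (principal (truncated_cone \<theta> M)))"
      using inv by (simp add: is_F_inverse_def)
    show "filterlim (\<lambda>y. im_axis (c * y)) (inf at_infinity (principal (truncated_cone \<theta> M))) at_top"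
      unfolding filterlim_inf filterlim_principal
    proof
      show "filterlim (\<lambda>y. im_axis (c * y)) at_infinity at_top"
      proof (rule filterlim_norm_at_top_imp_at_infinity)
        have "filterlim (\<lambda>y. \<bar>c\<bar> * y) at_top at_top"
          using c by (intro filterlim_tendsto_pos_mult_at_top[OF tendsto_const] filterlim_ident) simp
        then show "filterlim (\<lambda>y. norm (im_axis (c * y))) at_top at_top"
          by (rule filterlim_at_top_mono)
            (simp add: norm_mult abs_mult mult_left_mono eventually_at_top_linorder)
      qed
      show "eventually (\<lambda>y. im_axis (c * y) \<in> truncated_cone \<theta> M) at_top"
        using eventually_ge_at_top[of "\<bar>M\<bar> / \<bar>c\<bar>"]
      proof eventually_elim
        case (elim y)
        then have "\<bar>M\<bar> \<le> \<bar>c\<bar> * y" using c by (simp add: field_simps)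
        moreover have "\<bar>c\<bar> * y \<le> \<bar>c * y\<bar>" by (simp add: abs_mult mult_left_mono)
        ultimately have "M \<le> \<bar>c * y\<bar>" by linarith
        then show ?case by (rule in_cone)
      qed
    qed
  qed
qed

lemma bifree_triplet_imp_levy_law:
  assumes \<mu>: "\<mu> \<in> borel_prob" and triplet: "bifree_triplet \<mu> v A \<tau>"
  obtains g R where "bifree_levy_law \<mu> \<tau> v A g R"
proof -
  from triplet obtain \<Gamma> where "\<Gamma> \<in> truncated_cones"
    and phi: "has_bifree_phi \<mu> \<Gamma> (bifree_levy_khintchine v A \<tau>)"
    and A: "pos_semidef A" and T: "sets \<tau> = sets borel" "integrable \<tau> (\<lambda>x. min 1 ((norm x)\<^sup>2))"
    unfolding bifree_triplet_def by blast
  then obtain \<theta> M where \<theta>: "0 < \<theta>" and \<Gamma>: "\<Gamma> = truncated_cone \<theta> M"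
    unfolding truncated_cones_def by blast
  from phi obtain g1 g2 where inv: "is_F_inverse (marginal 1 \<mu>) \<Gamma> g1" "is_F_inverse (marginal 2 \<mu>) \<Gamma> g2"
    and eq: "\<And>z w. z \<in> \<Gamma> \<Longrightarrow> w \<in> \<Gamma> \<Longrightarrow> cauchy_G2 \<mu> (g1 z) (g2 w) \<noteq> 0 \<and>
      bifree_levy_khintchine v A \<tau> z w =
        (g1 z - z) / z + (g2 w - w) / w + 1 - 1 / (z * w * cauchy_G2 \<mu> (g1 z) (g2 w))"
    unfolding has_bifree_phi_def by blast
  have M: "prob_space \<mu>" "sets \<mu> = sets borel" using \<mu> by (simp_all add: borel_prob_def)
  define g where "g i = (if i = 1 then g1 else g2)" for i :: 2
  have g: "g 1 = g1" "g 2 = g2" by (simp_all add: g_def)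
  have inv': "is_F_inverse (marginal i \<mu>) (truncated_cone \<theta> M) (g i)" for i
    using inv exhaust_2[of i] g \<Gamma> by auto
  note facts = is_F_inverse_im_axis[OF inv' \<theta> M(2)]
  have "bifree_levy_law \<mu> \<tau> v A g (max 1 M)"
  proof (intro bifree_levy_law.intro bifree_levy_law_axioms.intro levy_measure.intro M A T)
    show "1 \<le> max 1 M" by simp
    show "g i (im_axis y) \<notin> \<real>" if "max 1 M \<le> \<bar>y\<bar>" for i y
      by (rule facts(1)) (use that in simp)
    show "(\<integral>x. 1 / (g i (im_axis y) - complex_of_real (x $ i)) \<partial>\<mu>) = 1 / im_axis y"
      if "max 1 M \<le> \<bar>y\<bar>" for i y
      by (rule facts(2)) (use that in auto)
    show "((\<lambda>y. g i (im_axis (c * y)) / im_axis (c * y)) \<longlongrightarrow> 1) at_top" if "c \<noteq> 0" for i c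
      by (rule facts(3)[OF that])
    show "cauchy_G2 \<mu> (g 1 (im_axis y)) (g 2 (im_axis y')) \<noteq> 0 \<and>
      bifree_levy_khintchine v A \<tau> (im_axis y) (im_axis y') =
        (g 1 (im_axis y) - im_axis y) / im_axis y + (g 2 (im_axis y') - im_axis y') / im_axis y'
        + 1 - 1 / (im_axis y * im_axis y' * cauchy_G2 \<mu> (g 1 (im_axis y)) (g 2 (im_axis y')))"
      if "max 1 M \<le> \<bar>y\<bar>" "max 1 M \<le> \<bar>y'\<bar>" for y y'
      unfolding g by (rule eq) (use that in \<open>simp_all add: \<Gamma> im_axis_in_truncated_cone[OF \<theta>]\<close>)
  qed
  then show ?thesis by (rule that)
qed

theorem theorem7p4:
  fixes \<mu> \<tau> :: "(real^2) measure" and v :: "real^2" and A :: "real^2^2"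
  assumes "bifree_inf_divisible \<mu>"
    and "bifree_triplet \<mu> v A \<tau>"
  shows "(non_full \<mu> \<longleftrightarrow>
            \<not> invertible A \<and>
            (\<exists>u. u \<noteq> 0 \<and> A *v u = 0 \<and> supported_on \<tau> {x. u \<bullet> x = 0})) \<and>
         (\<forall>u. u \<noteq> 0 \<and> A *v u = 0 \<and> supported_on \<tau> {x. u \<bullet> x = 0} \<longrightarrow>
            supported_on \<mu> {x. u \<bullet> x = u \<bullet> v})"
proof -
  have "\<mu> \<in> borel_prob" using assms(1) by (simp add: bifree_inf_divisible_def)
  then obtain g R where "bifree_levy_law \<mu> \<tau> v A g R"
    using bifree_triplet_imp_levy_law[OF _ assms(2)] by blast
  then interpret bifree_levy_law \<mu> \<tau> v A g R .
  have supp_\<mu>: "supported_on \<mu> {x. u \<bullet> x = c} \<longleftrightarrow> (AE x in \<mu>. u \<bullet> x = c)" for u c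
    by (simp add: supported_on_iff_AE closed_hyperplane)
  have supp_\<tau>: "supported_on \<tau> {x. u \<bullet> x = c} \<longleftrightarrow> (AE x in \<tau>. u \<bullet> x = c)" for u c
    by (simp add: supported_on_iff_AE closed_hyperplane)
  have non_full: "non_full \<mu> \<longleftrightarrow> (\<exists>u c. u \<noteq> 0 \<and> (AE x in \<mu>. u \<bullet> x = c))"
    unfolding full_def straight_line_def supp_\<mu>[symmetric] by blast
  have singular: "\<not> invertible A" if "u \<noteq> 0" "A *v u = 0" for u
  proof
    assume "invertible A"
    then obtain B where "B ** A = mat 1" unfolding invertible_def by blast
    then have "u = B *v (A *v u)" by (simp add: matrix_vector_mul_assoc)
    then show False using that by simp
  qed
  show ?thesis
    unfolding non_full supp_\<mu> supp_\<tau>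
  proof (intro conjI iffI allI impI)
    assume "\<exists>u c. u \<noteq> 0 \<and> (AE x in \<mu>. u \<bullet> x = c)"
    then obtain u c where u: "u \<noteq> 0" "AE x in \<mu>. u \<bullet> x = c" by blast
    note u' = AE_levy_line_if_law[OF u]
    show "\<not> invertible A" by (rule singular[OF u(1) u'(1)])
    show "\<exists>u. u \<noteq> 0 \<and> A *v u = 0 \<and> (AE x in \<tau>. u \<bullet> x = 0)"
      using u(1) u' by (intro exI[of _ u] conjI)
  next
    assume "\<not> invertible A \<and> (\<exists>u. u \<noteq> 0 \<and> A *v u = 0 \<and> (AE x in \<tau>. u \<bullet> x = 0))"
    then obtain u where u: "u \<noteq> 0" "A *v u = 0" "AE x in \<tau>. u \<bullet> x = 0" by (elim conjE exE)
    show "\<exists>u c. u \<noteq> 0 \<and> (AE x in \<mu>. u \<bullet> x = c)"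
      using u(1) AE_law_line_if_levy[OF u] by (intro exI conjI)
  next
    fix u assume "u \<noteq> 0 \<and> A *v u = 0 \<and> (AE x in \<tau>. u \<bullet> x = 0)"
    then show "AE x in \<mu>. u \<bullet> x = u \<bullet> v" using AE_law_line_if_levy by (elim conjE)
  qed
qed

end
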